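(* Let $X$ be a smooth vector field on an orientable $m$-dimensional smooth manifold $M$. Suppose that there exists a volume form $\Omega$ on $M$ such that $$\mathbf{i}_X\Omega=\mathrm{d}\varrho$$ for some differential $(m-2)$-form $\varrho\in\Gamma(\wedge^{m-2}T^*M)$. If $\varrho$ is of rank at most two and admits an integrating factor $a\in C^\infty(M)$, in the sense that $\mathrm{d}(a\varrho)=0$, then $X$ is Hamiltonian on the open set $U:=\{a\neq 0\}$ with respect to a unimodular Poisson structure $\pi$ of rank at most two on $M$; that is, $X|_U=\pi^\sharp\mathrm{d}h$ for some $h\in C^\infty(U)$.
   Context: Rank of an $(m-2)$-form: in local coordinates $(x^1,\dots,x^m)$ write $\varrho=\sum_{i<j}\varrho_{ij}\,\mathrm{d}x^1\wedge\cdots\wedge\widehat{\mathrm{d}x^i}\wedge\cdots\wedge\widehat{\mathrm{d}x^j}\wedge\cdots\wedge\mathrm{d}x^m$ (hatted factors omitted) and $\varrho_{ji}=-\varrho_{ij}$; the rank of $\varrho$ at $x$ is the rank of the matrix $[\varrho_{ij}(x)]$. A Poisson structure is a bivector field $\pi$ with $[\pi,\pi]=0$ (Schouten–Nijenhuis bracket); $\pi^\sharp\alpha=\mathbf{i}_\alpha\pi=\pi(\alpha,\cdot)$, and the rank of $\pi$ at $x$ is $\dim\pi^\sharp(T^*_xM)$. Hamiltonian vector fields are those of the form $\pi^\sharp\mathrm{d}h$. A Poisson structure on an orientable manifold is unimodular if there is a volume form invariant under the flows of all Hamiltonian vector fields. *)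

theory Defs
  imports "HOL-Analysis.Analysis"
begin

section \<open>Smooth maps between normed spaces\<close>

text \<open>Only used for open \<open>S\<close> in finite-dimensional spaces, where all directional derivatives of
  order at most \<open>k\<close> existing and being continuous is the usual notion of class C^k.\<close>

primrec Ck_on :: "nat \<Rightarrow> 'a::real_normed_vector set \<Rightarrow> ('a \<Rightarrow> 'b::real_normed_vector) \<Rightarrow> bool" where
  "Ck_on 0 S f \<longleftrightarrow> continuous_on S f"
| "Ck_on (Suc k) S f \<longleftrightarrow>
     (\<forall>x\<in>S. f differentiable (at x)) \<and> (\<forall>v. Ck_on k S (\<lambda>x. frechet_derivative f (at x) v))"

definition smooth_on :: "'a::real_normed_vector set \<Rightarrow> ('a \<Rightarrow> 'b::real_normed_vector) \<Rightarrow> bool" where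
  "smooth_on S f \<longleftrightarrow> (\<forall>k. Ck_on k S f)"


section \<open>Smooth manifolds\<close>

text \<open>The model space is \<^typ>\<open>real^'m\<close>, so the dimension is \<^term>\<open>CARD('m)\<close>. A chart is a pair of its
  domain and its coordinate map; values of the coordinate map outside the domain are irrelevant.\<close>

type_synonym ('a, 'm) chart = "'a set \<times> ('a \<Rightarrow> real^'m)"

definition chart_dom :: "('a, 'm::finite) chart \<Rightarrow> 'a set" where
  "chart_dom c = fst c"

definition chart_map :: "('a, 'm::finite) chart \<Rightarrow> 'a \<Rightarrow> real^'m" where
  "chart_map c = snd c"

definition chart_img :: "('a, 'm::finite) chart \<Rightarrow> (real^'m) set" where
  "chart_img c = chart_map c ` chart_dom c"

definition chart_inv :: "('a, 'm::finite) chart \<Rightarrow> real^'m \<Rightarrow> 'a" where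
  "chart_inv c = inv_into (chart_dom c) (chart_map c)"

definition is_chart :: "'a topology \<Rightarrow> ('a, 'm::finite) chart \<Rightarrow> bool" where
  "is_chart M c \<longleftrightarrow>
     openin M (chart_dom c) \<and> open (chart_img c) \<and>
     homeomorphic_map (subtopology M (chart_dom c)) (top_of_set (chart_img c)) (chart_map c)"

definition transition :: "('a, 'm::finite) chart \<Rightarrow> ('a, 'm) chart \<Rightarrow> real^'m \<Rightarrow> real^'m" where
  "transition c d = chart_map d \<circ> chart_inv c"

definition compatible :: "('a, 'm::finite) chart \<Rightarrow> ('a, 'm) chart \<Rightarrow> bool" where
  "compatible c d \<longleftrightarrow>
     smooth_on (chart_map c ` (chart_dom c \<inter> chart_dom d)) (transition c d) \<and>
     smooth_on (chart_map d ` (chart_dom c \<inter> chart_dom d)) (transition d c)"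

text \<open>\<open>A\<close> is a smooth structure, i.e. a maximal smooth atlas.\<close>

definition smooth_manifold :: "'a topology \<Rightarrow> ('a, 'm::finite) chart set \<Rightarrow> bool" where
  "smooth_manifold M A \<longleftrightarrow>
     Hausdorff_space M \<and> second_countable M \<and>
     (\<forall>c\<in>A. is_chart M c) \<and>
     (\<Union>c\<in>A. chart_dom c) = topspace M \<and>
     (\<forall>c\<in>A. \<forall>d\<in>A. compatible c d) \<and>
     (\<forall>c. is_chart M c \<and> (\<forall>d\<in>A. compatible c d) \<longrightarrow> c \<in> A)"

definition jacobian :: "('a, 'm::finite) chart \<Rightarrow> ('a, 'm) chart \<Rightarrow> real^'m \<Rightarrow> real^'m^'m" where
  "jacobian c d x = matrix (frechet_derivative (transition c d) (at x))"

definition orientable :: "'a topology \<Rightarrow> ('a, 'm::finite) chart set \<Rightarrow> bool" where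
  "orientable M A \<longleftrightarrow>
     (\<exists>B\<subseteq>A. (\<Union>c\<in>B. chart_dom c) = topspace M \<and>
        (\<forall>c\<in>B. \<forall>d\<in>B. \<forall>p\<in>chart_dom c \<inter> chart_dom d. det (jacobian c d (chart_map c p)) > 0))"

text \<open>For open \<open>U\<close>; the values of \<open>f\<close> outside \<open>U\<close> are irrelevant.\<close>

definition smooth_fun_on :: "('a, 'm::finite) chart set \<Rightarrow> 'a set \<Rightarrow> ('a \<Rightarrow> real) \<Rightarrow> bool" where
  "smooth_fun_on A U f \<longleftrightarrow>
     (\<forall>c\<in>A. smooth_on (chart_map c ` (chart_dom c \<inter> U)) (f \<circ> chart_inv c))"


section \<open>Tensor fields\<close>

text \<open>A tensor field is the family of its representatives in the charts of the smooth structure: a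
  smooth function on the image of each chart, subject to the tensorial transformation law under
  change of coordinates. Values outside the image of a chart are irrelevant, so fields are compared
  by \<open>field_eq_on\<close>.\<close>

type_synonym ('a, 'm, 't) field = "('a, 'm) chart \<Rightarrow> real^'m \<Rightarrow> 't"

definition field_eq_on ::
  "('a, 'm::finite) chart set \<Rightarrow> 'a set \<Rightarrow> ('a, 'm, 't) field \<Rightarrow> ('a, 'm, 't) field \<Rightarrow> bool" where
  "field_eq_on A U F G \<longleftrightarrow>
     (\<forall>c\<in>A. \<forall>p\<in>chart_dom c \<inter> U. F c (chart_map c p) = G c (chart_map c p))"

definition vector_field :: "('a, 'm::finite) chart set \<Rightarrow> ('a, 'm, real^'m) field \<Rightarrow> bool" where
  "vector_field A X \<longleftrightarrow>
     (\<forall>c\<in>A. smooth_on (chart_img c) (X c)) \<and>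
     (\<forall>c\<in>A. \<forall>d\<in>A. \<forall>p\<in>chart_dom c \<inter> chart_dom d.
        X d (chart_map d p) = jacobian c d (chart_map c p) *v X c (chart_map c p))"

subsection \<open>Differential forms\<close>

text \<open>An alternating \<open>k\<close>-form is a function on lists of vectors, with the value \<open>0\<close> on lists of
  length other than \<open>k\<close>.\<close>

definition alternating_form :: "nat \<Rightarrow> ((real^'m::finite) list \<Rightarrow> real) \<Rightarrow> bool" where
  "alternating_form k w \<longleftrightarrow>
     (\<forall>vs. length vs \<noteq> k \<longrightarrow> w vs = 0) \<and>
     (\<forall>vs i. length vs = k \<and> i < k \<longrightarrow> linear (\<lambda>v. w (vs[i := v]))) \<and>
     (\<forall>vs i j. length vs = k \<and> i < j \<and> j < k \<and> vs ! i = vs ! j \<longrightarrow> w vs = 0)"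

type_synonym ('a, 'm) form = "('a, 'm, (real^'m) list \<Rightarrow> real) field"

definition form_field :: "nat \<Rightarrow> ('a, 'm::finite) chart set \<Rightarrow> ('a, 'm) form \<Rightarrow> bool" where
  "form_field k A \<omega> \<longleftrightarrow>
     (\<forall>c\<in>A. \<forall>x\<in>chart_img c. alternating_form k (\<omega> c x)) \<and>
     (\<forall>c\<in>A. \<forall>vs. smooth_on (chart_img c) (\<lambda>x. \<omega> c x vs)) \<and>
     (\<forall>c\<in>A. \<forall>d\<in>A. \<forall>p\<in>chart_dom c \<inter> chart_dom d. \<forall>vs.
        \<omega> c (chart_map c p) vs =
        \<omega> d (chart_map d p) (map (\<lambda>v. jacobian c d (chart_map c p) *v v) vs))"

definition volume_form :: "('a, 'm::finite) chart set \<Rightarrow> ('a, 'm) form \<Rightarrow> bool" where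
  "volume_form A \<mu> \<longleftrightarrow>
     form_field CARD('m) A \<mu> \<and> (\<forall>c\<in>A. \<forall>x\<in>chart_img c. \<exists>vs. \<mu> c x vs \<noteq> 0)"

definition interior_product ::
  "('a, 'm::finite, real^'m) field \<Rightarrow> ('a, 'm) form \<Rightarrow> ('a, 'm) form" where
  "interior_product X \<omega> c x vs = \<omega> c x (X c x # vs)"

definition scale_form :: "('a \<Rightarrow> real) \<Rightarrow> ('a, 'm::finite) form \<Rightarrow> ('a, 'm) form" where
  "scale_form a \<omega> c x vs = a (chart_inv c x) * \<omega> c x vs"

text \<open>The exterior derivative in a chart, evaluated on constant vector fields, whose mutual Lie
  brackets vanish:
  \<open>(d\<omega>)(v\<^sub>0,\<dots>,v\<^sub>k) = (\<Sum>i\<le>k. (-1)^i * D\<^bsub>v\<^sub>i\<^esub> (\<omega>(v\<^sub>0,\<dots>,v\<^sub>k)))\<close>, with \<open>v\<^sub>i\<close> omitted from the arguments of \<open>\<omega>\<close>.\<close>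

definition ext_deriv :: "('a, 'm::finite) form \<Rightarrow> ('a, 'm) form" where
  "ext_deriv \<omega> c x vs =
     (\<Sum>i<length vs. (-1) ^ i *
        frechet_derivative (\<lambda>y. \<omega> c y (take i vs @ drop (Suc i) vs)) (at x) (vs ! i))"

text \<open>For an \<open>(m-2)\<close>-form, the coefficient of the basis form with \<open>dx\<^sup>i\<close> and \<open>dx\<^sup>j\<close> omitted is the
  value on the remaining coordinate vectors, taken in increasing order of their indices.\<close>

definition coeff_matrix ::
  "('a, 'm::{finite, linorder}) form \<Rightarrow> ('a, 'm) chart \<Rightarrow> (real, 'm) vec \<Rightarrow> ((real, 'm) vec, 'm) vec" where
  "coeff_matrix \<omega> c x =
     (let b = (\<lambda>i j. \<omega> c x (map (\<lambda>k. axis k 1) (sorted_list_of_set (- {i, j}))))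
      in \<chi> i j. if i < j then b i j else if j < i then - b j i else 0)"

definition form_rank ::
  "('a, 'm::{finite, linorder}) form \<Rightarrow> ('a, 'm) chart \<Rightarrow> (real, 'm) vec \<Rightarrow> nat" where
  "form_rank \<omega> c x = rank (coeff_matrix \<omega> c x)"

subsection \<open>Bivector fields and Poisson structures\<close>

definition partial :: "'m \<Rightarrow> (real^'m::finite \<Rightarrow> real) \<Rightarrow> real^'m \<Rightarrow> real" where
  "partial i f x = frechet_derivative f (at x) (axis i 1)"

text \<open>The differential of a function, a covector field given by its components.\<close>

definition differential :: "('a \<Rightarrow> real) \<Rightarrow> ('a, 'm::finite, real^'m) field" where
  "differential h c x = (\<chi> i. partial i (h \<circ> chart_inv c) x)"

text \<open>A bivector is given by its components \<open>\<pi>\<^sup>i\<^sup>j = \<pi>(dx\<^sup>i, dx\<^sup>j)\<close>.\<close>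

type_synonym ('a, 'm) bivector = "('a, 'm, real^'m^'m) field"

definition bivector_field :: "('a, 'm::finite) chart set \<Rightarrow> ('a, 'm) bivector \<Rightarrow> bool" where
  "bivector_field A \<pi> \<longleftrightarrow>
     (\<forall>c\<in>A. \<forall>x\<in>chart_img c. transpose (\<pi> c x) = - \<pi> c x) \<and>
     (\<forall>c\<in>A. smooth_on (chart_img c) (\<pi> c)) \<and>
     (\<forall>c\<in>A. \<forall>d\<in>A. \<forall>p\<in>chart_dom c \<inter> chart_dom d.
        \<pi> d (chart_map d p) =
        jacobian c d (chart_map c p) ** \<pi> c (chart_map c p) ** transpose (jacobian c d (chart_map c p)))"

text \<open>\<open>\<pi>\<^sup>\<sharp>\<alpha> = \<pi>(\<alpha>, \<cdot>)\<close>, that is \<open>(\<pi>\<^sup>\<sharp>\<alpha>)\<^sup>j = (\<Sum>i. \<alpha>\<^sub>i * \<pi>\<^sup>i\<^sup>j)\<close>.\<close>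

definition sharp ::
  "('a, 'm::finite) bivector \<Rightarrow> ('a, 'm, real^'m) field \<Rightarrow> ('a, 'm, real^'m) field" where
  "sharp \<pi> \<alpha> c x = \<alpha> c x v* \<pi> c x"

definition bivector_rank :: "('a, 'm::finite) bivector \<Rightarrow> ('a, 'm) chart \<Rightarrow> real^'m \<Rightarrow> nat" where
  "bivector_rank \<pi> c x = dim (range (\<lambda>\<alpha>. \<alpha> v* \<pi> c x))"

text \<open>Components \<open>[P,Q](dx\<^sup>i, dx\<^sup>j, dx\<^sup>k)\<close> of the Schouten-Nijenhuis bracket of bivector fields, obtained
  from the rule \<open>[X\<and>Y, Z\<and>W] = [X,Z]\<and>Y\<and>W - [X,W]\<and>Y\<and>Z - [Y,Z]\<and>X\<and>W + [Y,W]\<and>X\<and>Z\<close> applied to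
  \<open>P = 1/2 (\<Sum>i j. P\<^sup>i\<^sup>j \<partial>\<^sub>i\<and>\<partial>\<^sub>j)\<close> and \<open>Q = 1/2 (\<Sum>k l. Q\<^sup>k\<^sup>l \<partial>\<^sub>k\<and>\<partial>\<^sub>l)\<close>.
  The other sign convention in use changes it only by an overall sign.\<close>

definition schouten ::
  "('a, 'm::finite) bivector \<Rightarrow> ('a, 'm) bivector \<Rightarrow> ('a, 'm, 'm \<Rightarrow> 'm \<Rightarrow> 'm \<Rightarrow> real) field" where
  "schouten P Q c x i j k =
     (let t = (\<lambda>i j k. \<Sum>l\<in>UNIV. Q c x $ k $ l * partial l (\<lambda>y. P c y $ i $ j) x
                            + P c x $ k $ l * partial l (\<lambda>y. Q c y $ i $ j) x)
      in t i j k + t j k i + t k i j)"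

definition poisson_structure ::
  "'a topology \<Rightarrow> ('a, 'm::finite) chart set \<Rightarrow> ('a, 'm) bivector \<Rightarrow> bool" where
  "poisson_structure M A \<pi> \<longleftrightarrow>
     bivector_field A \<pi> \<and> field_eq_on A (topspace M) (schouten \<pi> \<pi>) (\<lambda>c x i j k. 0)"


section \<open>Flows and unimodularity\<close>

text \<open>\<open>\<phi>\<close>, with flow domain \<open>D\<close>, is a smooth flow with infinitesimal generator \<open>X\<close>. Neither
  completeness of \<open>X\<close> nor maximality of \<open>D\<close> is required; the group law follows from uniqueness of
  integral curves.\<close>

definition is_flow ::
  "'a topology \<Rightarrow> ('a, 'm::finite) chart set \<Rightarrow> ('a, 'm, real^'m) field \<Rightarrow>
   (real \<times> 'a) set \<Rightarrow> (real \<Rightarrow> 'a \<Rightarrow> 'a) \<Rightarrow> bool" where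
  "is_flow M A X D \<phi> \<longleftrightarrow>
     openin (prod_topology euclideanreal M) D \<and>
     (\<forall>p\<in>topspace M. (0, p) \<in> D \<and> is_interval {t. (t, p) \<in> D}) \<and>
     continuous_map (subtopology (prod_topology euclideanreal M) D) M (\<lambda>(t, p). \<phi> t p) \<and>
     (\<forall>c\<in>A. \<forall>d\<in>A.
        smooth_on {(t, x). x \<in> chart_img c \<and> (t, chart_inv c x) \<in> D \<and> \<phi> t (chart_inv c x) \<in> chart_dom d}
          (\<lambda>(t, x). chart_map d (\<phi> t (chart_inv c x)))) \<and>
     (\<forall>p\<in>topspace M. \<phi> 0 p = p) \<and>
     (\<forall>(t, p)\<in>D. \<forall>d\<in>A. \<phi> t p \<in> chart_dom d \<longrightarrow>
        ((\<lambda>s. chart_map d (\<phi> s p)) has_vector_derivative X d (chart_map d (\<phi> t p))) (at t))"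

text \<open>\<open>\<phi>\<^sub>t\<^sup>*\<omega> = \<omega>\<close> on \<open>{p. (t, p) \<in> D}\<close> for every \<open>t\<close> and every flow \<open>(D, \<phi>)\<close> of \<open>X\<close>, among them the
  maximal one.\<close>

definition flow_invariant ::
  "'a topology \<Rightarrow> ('a, 'm::finite) chart set \<Rightarrow> ('a, 'm, real^'m) field \<Rightarrow> ('a, 'm) form \<Rightarrow> bool" where
  "flow_invariant M A X \<omega> \<longleftrightarrow>
     (\<forall>D \<phi>. is_flow M A X D \<phi> \<longrightarrow>
        (\<forall>(t, p)\<in>D. \<forall>c\<in>A. \<forall>d\<in>A. p \<in> chart_dom c \<and> \<phi> t p \<in> chart_dom d \<longrightarrow>
           (\<forall>vs. \<omega> d (chart_map d (\<phi> t p))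
                   (map (frechet_derivative (\<lambda>x. chart_map d (\<phi> t (chart_inv c x))) (at (chart_map c p))) vs)
                 = \<omega> c (chart_map c p) vs)))"

definition unimodular ::
  "'a topology \<Rightarrow> ('a, 'm::finite) chart set \<Rightarrow> ('a, 'm) bivector \<Rightarrow> bool" where
  "unimodular M A \<pi> \<longleftrightarrow>
     (\<exists>\<mu>. volume_form A \<mu> \<and>
        (\<forall>h. smooth_fun_on A (topspace M) h \<longrightarrow> flow_invariant M A (sharp \<pi> (differential h)) \<mu>))"

end

theory Submission
  imports Defs
begin

text \<open>Let \<open>\<pi>\<close> be the bivector dual to \<open>a\<rho>\<close> with respect to \<open>\<Omega>\<close>. In coordinates, with \<open>w\<close> the density of \<open>\<Omega>\<close>,
  \<open>d(a\<rho>) = 0\<close> says that \<open>\<Sum>j. \<partial>\<^sub>j (w\<pi>\<^sup>i\<^sup>j) = 0\<close>. Hence every Hamiltonian vector field of \<open>\<pi>\<close> is divergence free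
  for \<open>\<Omega>\<close>, so its flow preserves \<open>\<Omega>\<close> by Liouville's formula. As \<open>\<pi>\<close> has rank at most two, it satisfies the
  Pluecker relations; differentiating these and using the divergence condition gives \<open>[\<pi>,\<pi>] = 0\<close>.
  Finally \<open>da \<and> \<rho> + a d\<rho> = 0\<close> shows \<open>i\<^sub>X\<Omega> = d(1/a) \<and> a\<rho>\<close> where \<open>a \<noteq> 0\<close>, so that \<open>X\<close> has the Hamiltonian
  function \<open>1/a\<close>.\<close>

section \<open>Calculus of smooth maps\<close>

text \<open>Dualising \<open>a\<rho>\<close> instead of \<open>\<rho>\<close> is what makes \<pi>
  global: its components carry the factor \<open>a\<close>, so it is smooth on all of
  \<open>M\<close> and vanishes at the zeros of \<open>a\<close>; only the Hamiltonian function is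
  confined to \<open>U\<close>. The rank bound passes from \<open>\<rho>\<close> to \<pi> pointwise,
  since multiplication by \<open>a\<close> and by diagonal matrices cannot raise a rank. It is
  essential for the bracket: a divergence-free bivector does not in general satisfy the Jacobi
  identity. Two obstacles shape the proof. A tensor field is a family of chart representatives, so
  \<pi>, given by a coordinate formula, has to be shown to transform correctly; this rests on the
  injectivity of contraction with a volume form instead of on minors of the Jacobian. Invariance of
  \<Omega> is demanded along every local flow, and an orbit may leave any chart; hence Liouville's
  computation is made in one chart, shown independent of the target chart, and joined along the
  interval of times of an orbit.\<close>

lemma Ck_on_cong:
  assumes "open S" "\<And>x. x \<in> S \<Longrightarrow> f x = g x" "Ck_on k S f"
  shows "Ck_on k S g"
  using assms(2,3)
proof (induction k arbitrary: f g)
  case 0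
  then show ?case by (auto cong: continuous_on_cong)
next
  case (Suc k)
  have d: "(g has_derivative frechet_derivative f (at x)) (at x)" if "x \<in> S" for x
    using Suc.prems that assms(1)
    by (auto intro: has_derivative_transform_within_open simp: frechet_derivative_works)
  have eq: "frechet_derivative f (at x) v = frechet_derivative g (at x) v" if "x \<in> S" for x v
    using frechet_derivative_at[OF d[OF that]] by simp
  have "Ck_on k S (\<lambda>x. frechet_derivative g (at x) v)" for v
    by (rule Suc.IH[of "\<lambda>x. frechet_derivative f (at x) v"]) (use eq Suc.prems in auto)
  with d show ?case by (auto simp: differentiable_def)
qed

text \<open>At order zero, differentiability supplies continuity. The lemma serves the product and
  reciprocal rules, where undifferentiated factors reappear at the lower order.\<close>

lemma Ck_on_Suc_D: "Ck_on (Suc k) S f \<Longrightarrow> Ck_on k S f"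
proof (induction k arbitrary: f)
  case 0
  then show ?case
    by (auto intro!: continuous_at_imp_continuous_on differentiable_imp_continuous_within)
next
  case (Suc k)
  then show ?case by (metis Ck_on.simps(2))
qed

lemma Ck_on_subset: "Ck_on k S f \<Longrightarrow> T \<subseteq> S \<Longrightarrow> Ck_on k T f"
  by (induction k arbitrary: f) (auto intro: continuous_on_subset)

lemma Ck_on_const: "Ck_on k S (\<lambda>x. c)"
  by (induction k arbitrary: c) auto

lemma Ck_on_add:
  assumes "open S" "Ck_on k S f" "Ck_on k S g"
  shows "Ck_on k S (\<lambda>x. f x + g x)"
  using assms(2,3)
proof (induction k arbitrary: f g)
  case 0
  then show ?case by (simp add: continuous_on_add continuous_on_mult)
next
  case (Suc k)
  have d: "((\<lambda>x. f x + g x) has_derivative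
      (\<lambda>v. frechet_derivative f (at x) v + frechet_derivative g (at x) v)) (at x)" if "x \<in> S" for x
    using Suc.prems that by (auto intro!: derivative_eq_intros simp: frechet_derivative_works)
  have "Ck_on k S (\<lambda>x. frechet_derivative (\<lambda>x. f x + g x) (at x) v)" for v
    by (rule Ck_on_cong[OF assms(1), of "\<lambda>x. frechet_derivative f (at x) v + frechet_derivative g (at x) v"])
      (use Suc in \<open>auto simp: frechet_derivative_at[OF d, symmetric]\<close>)
  with d show ?case by (auto simp: differentiable_def)
qed

lemma Ck_on_mult:
  fixes f g :: "'a::real_normed_vector \<Rightarrow> real"
  assumes "open S" "Ck_on k S f" "Ck_on k S g"
  shows "Ck_on k S (\<lambda>x. f x * g x)"
  using assms(2,3)
proof (induction k arbitrary: f g)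
  case 0
  then show ?case by (simp add: continuous_on_add continuous_on_mult)
next
  case (Suc k)
  have d: "((\<lambda>x. f x * g x) has_derivative
      (\<lambda>v. f x * frechet_derivative g (at x) v + frechet_derivative f (at x) v * g x)) (at x)" if "x \<in> S" for x
    using Suc.prems that by (auto intro!: derivative_eq_intros simp: frechet_derivative_works)
  have "Ck_on k S (\<lambda>x. frechet_derivative (\<lambda>x. f x * g x) (at x) v)" for v
    by (rule Ck_on_cong[OF assms(1), of "\<lambda>x. f x * frechet_derivative g (at x) v + frechet_derivative f (at x) v * g x"])
      (use Suc.IH Suc.prems Ck_on_Suc_D[OF Suc.prems(1)] Ck_on_Suc_D[OF Suc.prems(2)] in
        \<open>auto simp: frechet_derivative_at[OF d, symmetric] intro!: Ck_on_add assms(1)\<close>)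
  with d show ?case by (auto simp: differentiable_def)
qed

text \<open>The derivative of a reciprocal is again built from \<open>inverse (f x)\<close>, so the
  induction hypothesis covers those factors. The leading \<open>-1 *\<close> writes the negation as
  a product with a constant.\<close>

lemma Ck_on_inverse:
  fixes f :: "'a::real_normed_vector \<Rightarrow> real"
  assumes "open S" "Ck_on k S f" "\<And>x. x \<in> S \<Longrightarrow> f x \<noteq> 0"
  shows "Ck_on k S (\<lambda>x. inverse (f x))"
  using assms(2)
proof (induction k)
  case 0
  then show ?case using assms(3) by (simp add: continuous_on_inverse)
next
  case (Suc k)
  have d: "((\<lambda>x. inverse (f x)) has_derivative
      (\<lambda>v. -1 * (inverse (f x) * frechet_derivative f (at x) v * inverse (f x)))) (at x)" if "x \<in> S" for x
    using Suc.prems that assms(3) by (auto intro!: derivative_eq_intros simp: frechet_derivative_works)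
  have "Ck_on k S (\<lambda>x. frechet_derivative f (at x) v)" for v
    using Suc.prems by simp
  then have ck: "Ck_on k S (\<lambda>x. -1 * (inverse (f x) * frechet_derivative f (at x) v * inverse (f x)))" for v
    by (intro Ck_on_mult Ck_on_const assms(1) Suc.IH[OF Ck_on_Suc_D[OF Suc.prems(1)]])
  have "Ck_on k S (\<lambda>x. frechet_derivative (\<lambda>x. inverse (f x)) (at x) v)" for v
    by (rule Ck_on_cong[OF assms(1) _ ck[of v]]) (simp add: frechet_derivative_at[OF d, symmetric])
  with d show ?case by (auto simp: differentiable_def)
qed

text \<open>Convergence is tested in each coordinate, and boundedness follows by estimating the norm
  of a vector by the sum of the norms of its entries. The entries may lie in any normed space, so
  that smoothness can be passed on to matrices by iteration.\<close>

lemma has_derivative_vec_lambda: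
  fixes f :: "'n::finite \<Rightarrow> 'a::real_normed_vector \<Rightarrow> 'b::real_normed_vector"
  assumes "\<And>i. (f i has_derivative f' i) (at x within S)"
  shows "((\<lambda>y. \<chi> i. f i y) has_derivative (\<lambda>v. \<chi> i. f' i v)) (at x within S)"
proof -
  have bl: "bounded_linear (\<lambda>v. \<chi> i. f' i v)"
  proof (rule bounded_linear_intro)
    show "(\<chi> i. f' i (v + w)) = (\<chi> i. f' i v) + (\<chi> i. f' i w)" for v w
      by (simp add: vec_eq_iff linear_add[OF has_derivative_linear[OF assms]])
    show "(\<chi> i. f' i (r *\<^sub>R v)) = r *\<^sub>R (\<chi> i. f' i v)" for r v
      by (simp add: vec_eq_iff linear_cmul[OF has_derivative_linear[OF assms]])
    show "norm (\<chi> i. f' i v) \<le> norm v * (\<Sum>i\<in>UNIV. onorm (f' i))" for v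
    proof -
      have "norm (\<chi> i. f' i v) \<le> (\<Sum>i\<in>UNIV. norm (f' i v))"
        unfolding norm_vec_def by (rule order_trans[OF L2_set_le_sum]) simp_all
      also have "\<dots> \<le> (\<Sum>i\<in>UNIV. onorm (f' i) * norm v)"
        by (intro sum_mono onorm has_derivative_bounded_linear[OF assms])
      finally show ?thesis by (simp add: sum_distrib_left mult.commute)
    qed
  qed
  have "((\<lambda>y. (1 / norm (y - x)) *\<^sub>R (f i y - (f i x + f' i (y - x)))) \<longlongrightarrow> 0) (at x within S)" for i
    using assms[of i] by (simp add: has_derivative_within)
  then have "((\<lambda>y. \<chi> i. (1 / norm (y - x)) *\<^sub>R (f i y - (f i x + f' i (y - x)))) \<longlongrightarrow> (\<chi> i. 0)) (at x within S)"
    by (intro tendsto_vec_lambda)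
  moreover have "(\<chi> i. 0) = (0::'b^'n)" by (simp add: vec_eq_iff)
  moreover have "(\<chi> i. (1 / norm (y - x)) *\<^sub>R (f i y - (f i x + f' i (y - x)))) =
      (1 / norm (y - x)) *\<^sub>R ((\<chi> i. f i y) - ((\<chi> i. f i x) + (\<chi> i. f' i (y - x))))" for y
    by (simp add: vec_eq_iff)
  ultimately show ?thesis
    using bl by (simp add: has_derivative_within)
qed

lemma Ck_on_vec_lambda:
  fixes f :: "'n::finite \<Rightarrow> 'a::real_normed_vector \<Rightarrow> 'b::real_normed_vector"
  assumes "open S" "\<And>i. Ck_on k S (f i)"
  shows "Ck_on k S (\<lambda>x. \<chi> i. f i x)"
  using assms(2)
proof (induction k arbitrary: f)
  case 0
  then show ?case by (auto intro: continuous_on_vec_lambda)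
next
  case (Suc k)
  have d: "((\<lambda>x. \<chi> i. f i x) has_derivative (\<lambda>v. \<chi> i. frechet_derivative (f i) (at x) v)) (at x)"
    if "x \<in> S" for x
    using Suc.prems that by (intro has_derivative_vec_lambda) (auto simp: frechet_derivative_works)
  have "Ck_on k S (\<lambda>x. frechet_derivative (\<lambda>x. \<chi> i. f i x) (at x) v)" for v
    by (rule Ck_on_cong[OF assms(1), of "\<lambda>x. \<chi> i. frechet_derivative (f i) (at x) v"])
      (use Suc in \<open>auto simp: frechet_derivative_at[OF d, symmetric]\<close>)
  with d show ?case by (auto simp: differentiable_def)
qed

lemma smooth_on_subset: "smooth_on S f \<Longrightarrow> T \<subseteq> S \<Longrightarrow> smooth_on T f"
  by (auto simp: smooth_on_def intro: Ck_on_subset)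

lemma smooth_on_const: "smooth_on S (\<lambda>x. c)"
  by (simp add: smooth_on_def Ck_on_const)

lemma smooth_on_mult:
  fixes f g :: "'a::real_normed_vector \<Rightarrow> real"
  shows "open S \<Longrightarrow> smooth_on S f \<Longrightarrow> smooth_on S g \<Longrightarrow> smooth_on S (\<lambda>x. f x * g x)"
  by (simp add: smooth_on_def Ck_on_mult)

lemma smooth_on_inverse:
  fixes f :: "'a::real_normed_vector \<Rightarrow> real"
  shows "open S \<Longrightarrow> smooth_on S f \<Longrightarrow> (\<And>x. x \<in> S \<Longrightarrow> f x \<noteq> 0) \<Longrightarrow> smooth_on S (\<lambda>x. inverse (f x))"
  by (simp add: smooth_on_def Ck_on_inverse)

lemma smooth_on_vec_lambda:
  fixes f :: "'n::finite \<Rightarrow> 'a::real_normed_vector \<Rightarrow> 'b::real_normed_vector"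
  shows "open S \<Longrightarrow> (\<And>i. smooth_on S (f i)) \<Longrightarrow> smooth_on S (\<lambda>x. \<chi> i. f i x)"
  by (simp add: smooth_on_def Ck_on_vec_lambda)

lemma smooth_on_imp_differentiable: "smooth_on S f \<Longrightarrow> x \<in> S \<Longrightarrow> f differentiable (at x)"
  unfolding smooth_on_def using Ck_on.simps(2) by blast

lemma smooth_on_imp_continuous_on: "smooth_on S f \<Longrightarrow> continuous_on S f"
  unfolding smooth_on_def using Ck_on.simps(1) by blast

lemma smooth_on_frechet_derivative:
  "smooth_on S f \<Longrightarrow> smooth_on S (\<lambda>x. frechet_derivative f (at x) v)"
  unfolding smooth_on_def using Ck_on.simps(2) by blast

text \<open>The mean value theorem in direction \<open>u\<close> turns the second difference into a
  difference of two derivatives along \<open>u\<close>; linearising these at \<open>x\<close> leaves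
  \<open>L v\<close> up to a small error. The quotient is symmetric in \<open>u\<close> and
  \<open>v\<close>, which is the reason for computing its limit.\<close>

lemma second_difference_tendsto:
  fixes f :: "'a::real_normed_vector \<Rightarrow> real"
  assumes "open S" "x \<in> S" and diff: "\<And>y. y \<in> S \<Longrightarrow> f differentiable (at y)"
    and L: "((\<lambda>y. frechet_derivative f (at y) u) has_derivative L) (at x)"
  shows "((\<lambda>h. (f (x + h *\<^sub>R u + h *\<^sub>R v) - f (x + h *\<^sub>R u) - f (x + h *\<^sub>R v) + f x) / h\<^sup>2) \<longlongrightarrow> L v)
    (at_right 0)"
proof (rule tendstoI)
  fix e :: real assume "e > 0"
  \<comment> \<open>The summand 1 keeps \<open>N\<close> positive when both directions vanish; all
    points visited lie within \<open>h * N\<close> of \<open>x\<close>.\<close>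
  define N where "N = norm u + norm v + 1"
  have N: "N > 0" "norm u + norm v \<le> N" by (simp_all add: N_def add_nonneg_pos)
  \<comment> \<open>Two linearisation errors of size \<open>\<epsilon> * (h * N)\<close> add up to
    \<open>h * (e / 2)\<close>, which stays below \<open>e\<close> after division by
    \<open>h\<close>.\<close>
  define \<epsilon> where "\<epsilon> = e / (4 * N)"
  have "\<epsilon> > 0" using \<open>e > 0\<close> N by (simp add: \<epsilon>_def)
  obtain r where r: "r > 0" "ball x r \<subseteq> S" using assms(1,2) open_contains_ball by blast
  let ?D = "\<lambda>y. frechet_derivative f (at y) u"
  obtain d where d: "d > 0" "\<And>y. norm (y - x) < d \<Longrightarrow> norm (?D y - ?D x - L (y - x)) \<le> \<epsilon> * norm (y - x)"
    using L \<open>\<epsilon> > 0\<close> unfolding has_derivative_at_alt by metis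
  interpret L: bounded_linear L using L by (rule has_derivative_bounded_linear)
  have main: "dist ((f (x + h *\<^sub>R u + h *\<^sub>R v) - f (x + h *\<^sub>R u) - f (x + h *\<^sub>R v) + f x) / h\<^sup>2) (L v) < e"
    if h: "h > 0" "h < min r d / N" for h
  proof -
    have hN: "h * N < r" "h * N < d" using h N by (auto simp: field_simps)
    have small: "norm (s *\<^sub>R u + t *\<^sub>R v) \<le> h * N" if "0 \<le> s" "s \<le> h" "0 \<le> t" "t \<le> h" for s t
    proof -
      have "norm (s *\<^sub>R u + t *\<^sub>R v) \<le> s * norm u + t * norm v"
        using norm_triangle_ineq[of "s *\<^sub>R u" "t *\<^sub>R v"] that by simp
      also have "\<dots> \<le> h * norm u + h * norm v"
        using that by (intro add_mono mult_right_mono) auto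
      also have "\<dots> \<le> h * N" using h N by (simp add: distrib_left[symmetric])
      finally show ?thesis .
    qed
    have inS: "x + s *\<^sub>R u + t *\<^sub>R v \<in> S" if "0 \<le> s" "s \<le> h" "0 \<le> t" "t \<le> h" for s t
      using small[OF that] hN r(2) by (auto simp: dist_norm add.assoc norm_minus_commute subset_iff)
    define g where "g = (\<lambda>s. f (x + s *\<^sub>R u + h *\<^sub>R v) - f (x + s *\<^sub>R u))"
    have fd: "((\<lambda>s. f (x + s *\<^sub>R u + t *\<^sub>R v)) has_real_derivative ?D (x + s *\<^sub>R u + t *\<^sub>R v)) (at s)"
      if "0 \<le> s" "s \<le> h" "0 \<le> t" "t \<le> h" for s t
    proof -
      have "(f has_derivative frechet_derivative f (at (x + s *\<^sub>R u + t *\<^sub>R v))) (at (x + s *\<^sub>R u + t *\<^sub>R v))"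
        using diff[OF inS[OF that]] by (simp add: frechet_derivative_works)
      moreover have "((\<lambda>s. x + s *\<^sub>R u + t *\<^sub>R v) has_derivative (\<lambda>k. k *\<^sub>R u)) (at s)"
        by (auto intro!: derivative_eq_intros)
      ultimately have "((\<lambda>s. f (x + s *\<^sub>R u + t *\<^sub>R v)) has_derivative
          (\<lambda>k. frechet_derivative f (at (x + s *\<^sub>R u + t *\<^sub>R v)) (k *\<^sub>R u))) (at s)"
        using has_derivative_compose by fastforce
      moreover have "frechet_derivative f (at (x + s *\<^sub>R u + t *\<^sub>R v)) (k *\<^sub>R u) =
          ?D (x + s *\<^sub>R u + t *\<^sub>R v) * k" for k
        using linear_cmul[OF linear_frechet_derivative[OF diff[OF inS[OF that]]]] by simp
      ultimately show ?thesis by (simp add: has_field_derivative_def)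
    qed
    have "\<exists>z>0. z < h \<and> g h - g 0 = (h - 0) * (?D (x + z *\<^sub>R u + h *\<^sub>R v) - ?D (x + z *\<^sub>R u))"
      unfolding g_def
    proof (rule MVT2[OF h(1)])
      show "((\<lambda>s. f (x + s *\<^sub>R u + h *\<^sub>R v) - f (x + s *\<^sub>R u)) has_real_derivative
          (?D (x + s *\<^sub>R u + h *\<^sub>R v) - ?D (x + s *\<^sub>R u))) (at s)" if "0 \<le> s" "s \<le> h" for s
        using DERIV_diff[OF fd[of s h] fd[of s 0]] that h by simp
    qed
    then obtain z where z: "0 < z" "z < h" "g h - g 0 = h * (?D (x + z *\<^sub>R u + h *\<^sub>R v) - ?D (x + z *\<^sub>R u))"
      by auto
    let ?y = "z *\<^sub>R u + h *\<^sub>R v" and ?y' = "z *\<^sub>R u + 0 *\<^sub>R v"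
    have "norm (?D (x + ?y) - ?D x - L ?y) \<le> \<epsilon> * norm ?y"
      using d(2)[of "x + ?y"] small[of z h] z hN h by auto
    moreover have "norm (?D (x + ?y') - ?D x - L ?y') \<le> \<epsilon> * norm ?y'"
      using d(2)[of "x + ?y'"] small[of z 0] z hN h by auto
    moreover have "\<epsilon> * norm ?y \<le> \<epsilon> * (h * N)" "\<epsilon> * norm ?y' \<le> \<epsilon> * (h * N)"
      using small[of z h] small[of z 0] z h \<open>\<epsilon> > 0\<close> by (auto intro!: mult_left_mono)
    moreover have "L ?y - L ?y' = h * L v" by (simp add: L.add L.scaleR)
    ultimately have "\<bar>(?D (x + ?y) - ?D (x + ?y')) - h * L v\<bar> \<le> 2 * (\<epsilon> * (h * N))"
      unfolding real_norm_def by linarith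
    also have "\<dots> = h * (e / 2)" using N by (simp add: \<epsilon>_def)
    finally have 1: "\<bar>(?D (x + ?y) - ?D (x + ?y')) - h * L v\<bar> \<le> h * (e / 2)" .
    have "f (x + h *\<^sub>R u + h *\<^sub>R v) - f (x + h *\<^sub>R u) - f (x + h *\<^sub>R v) + f x =
        h * (?D (x + ?y) - ?D (x + ?y'))"
      using z(3) by (simp add: g_def add.assoc)
    moreover have "h * E / h\<^sup>2 - l = (E - h * l) / h" for E l
      using h by (simp add: field_simps power2_eq_square)
    ultimately have "(f (x + h *\<^sub>R u + h *\<^sub>R v) - f (x + h *\<^sub>R u) - f (x + h *\<^sub>R v) + f x) / h\<^sup>2 - L v =
        ((?D (x + ?y) - ?D (x + ?y')) - h * L v) / h"
      by metis
    also have "\<bar>\<dots>\<bar> \<le> e / 2"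
      using 1 h by (simp add: abs_divide field_simps)
    finally show ?thesis using \<open>e > 0\<close> by (simp add: dist_real_def)
  qed
  have "min r d / N > 0" using r d N by simp
  then show "\<forall>\<^sub>F h in at_right 0. dist ((f (x + h *\<^sub>R u + h *\<^sub>R v) - f (x + h *\<^sub>R u) - f (x + h *\<^sub>R v) + f x) / h\<^sup>2) (L v) < e"
    unfolding eventually_at_right_field using main by (intro exI[of _ "min r d / N"]) auto
qed

text \<open>Exchanging \<open>u\<close> and \<open>v\<close> leaves the second difference unchanged,
  so both values are limits of one quotient.\<close>

lemma second_derivative_symmetric_real:
  fixes f :: "'a::real_normed_vector \<Rightarrow> real"
  assumes "open S" "x \<in> S" and diff: "\<And>y. y \<in> S \<Longrightarrow> f differentiable (at y)"
    and L: "((\<lambda>y. frechet_derivative f (at y) u) has_derivative L) (at x)"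
    and K: "((\<lambda>y. frechet_derivative f (at y) v) has_derivative K) (at x)"
  shows "L v = K u"
proof -
  have "((\<lambda>h. (f (x + h *\<^sub>R u + h *\<^sub>R v) - f (x + h *\<^sub>R u) - f (x + h *\<^sub>R v) + f x) / h\<^sup>2) \<longlongrightarrow> K u)
    (at_right 0)"
    using second_difference_tendsto[OF assms(1-3) K, of u] by (simp add: algebra_simps)
  with second_difference_tendsto[OF assms(1-3) L, of v] show ?thesis
    by (rule tendsto_unique[OF trivial_limit_at_right_real])
qed

text \<open>Pairing with an arbitrary \<open>b\<close> reduces this to real values. Vector values
  occur because the flow itself is differentiated twice in Liouville's formula.\<close>

lemma second_derivative_symmetric:
  fixes f :: "'a::real_normed_vector \<Rightarrow> 'b::real_inner"
  assumes "open S" "x \<in> S" and diff: "\<And>y. y \<in> S \<Longrightarrow> f differentiable (at y)"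
    and L: "((\<lambda>y. frechet_derivative f (at y) u) has_derivative L) (at x)"
    and K: "((\<lambda>y. frechet_derivative f (at y) v) has_derivative K) (at x)"
  shows "L v = K u"
proof -
  have "L v \<bullet> b = K u \<bullet> b" for b
  proof (rule second_derivative_symmetric_real[OF assms(1,2), of "\<lambda>y. f y \<bullet> b"])
    have fd: "((\<lambda>y. f y \<bullet> b) has_derivative (\<lambda>w. frechet_derivative f (at y) w \<bullet> b)) (at y)" if "y \<in> S" for y
      using diff[OF that] by (auto intro!: derivative_eq_intros simp: frechet_derivative_works)
    then show "(\<lambda>y. f y \<bullet> b) differentiable at y" if "y \<in> S" for y
      using that by (auto simp: differentiable_def)
    have eq: "frechet_derivative f (at y) w \<bullet> b = frechet_derivative (\<lambda>y. f y \<bullet> b) (at y) w" if "y \<in> S" for y w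
      using frechet_derivative_at[OF fd[OF that]] by metis
    show "((\<lambda>y. frechet_derivative (\<lambda>y. f y \<bullet> b) (at y) u) has_derivative (\<lambda>w. L w \<bullet> b)) (at x)"
      by (rule has_derivative_transform_within_open[OF _ assms(1,2) eq])
         (auto intro!: derivative_eq_intros L)
    show "((\<lambda>y. frechet_derivative (\<lambda>y. f y \<bullet> b) (at y) v) has_derivative (\<lambda>w. K w \<bullet> b)) (at x)"
      by (rule has_derivative_transform_within_open[OF _ assms(1,2) eq])
         (auto intro!: derivative_eq_intros K)
  qed
  then have "(L v - K u) \<bullet> (L v - K u) = 0" by (simp add: inner_diff_left)
  then show ?thesis by simp
qed

text \<open>Jacobi's formula along a linear differential equation. Differentiating one row at a time
  replaces row \<open>i\<close> by a combination of the rows of \<open>C t\<close>; every term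
  except the multiple of row \<open>i\<close> has a repeated row, so only the diagonal entry of
  \<open>A\<close> survives.\<close>

lemma has_real_derivative_det:
  fixes C :: "real \<Rightarrow> real^'n^'n::finite"
  assumes "\<And>i j. ((\<lambda>s. C s $ i $ j) has_real_derivative (A ** C t) $ i $ j) (at t)"
  shows "((\<lambda>s. det (C s)) has_real_derivative trace A * det (C t)) (at t)"
proof -
  let ?S = "{p. p permutes (UNIV::'n set)}"
  let ?R = "\<lambda>i v. (\<chi> r. if r = i then v else C t $ r) :: real^'n^'n"
  have row: "det (?R i ((A ** C t) $ i)) = A $ i $ i * det (C t)" for i
  proof -
    have row_eq: "(A ** C t) $ i = (\<Sum>k\<in>UNIV. A $ i $ k *s C t $ k)"
      by (simp add: vec_eq_iff matrix_matrix_mult_def)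
    have "det (?R i ((A ** C t) $ i)) = (\<Sum>k\<in>UNIV. det (?R i (A $ i $ k *s C t $ k)))"
      unfolding row_eq using det_linear_row_sum[of UNIV i "\<lambda>_ k. A $ i $ k *s C t $ k" "\<lambda>r. C t $ r"] by simp
    also have "\<dots> = (\<Sum>k\<in>UNIV. A $ i $ k * det (?R i (C t $ k)))"
      by (simp add: det_row_mul)
    also have "\<dots> = (\<Sum>k\<in>UNIV. if k = i then A $ i $ i * det (C t) else 0)"
    proof (rule sum.cong[OF refl])
      fix k
      have "?R i (C t $ i) = C t" by (simp add: vec_eq_iff)
      moreover have "det (?R i (C t $ k)) = 0" if "k \<noteq> i"
        by (rule det_identical_rows[OF that]) (use that in \<open>simp add: row_def\<close>)
      ultimately show "A $ i $ k * det (?R i (C t $ k)) = (if k = i then A $ i $ i * det (C t) else 0)"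
        by auto
    qed
    finally show ?thesis by simp
  qed
  have "((\<lambda>s. \<Sum>p\<in>?S. of_int (sign p) * (\<Prod>i\<in>UNIV. C s $ i $ p i)) has_real_derivative
     (\<Sum>p\<in>?S. of_int (sign p) * (\<Sum>i\<in>UNIV. (A ** C t) $ i $ p i * (\<Prod>j\<in>UNIV - {i}. C t $ j $ p j)))) (at t)"
    by (intro DERIV_sum DERIV_cmult has_field_derivative_prod assms)
  also have "(\<Sum>p\<in>?S. of_int (sign p) * (\<Sum>i\<in>UNIV. (A ** C t) $ i $ p i * (\<Prod>j\<in>UNIV - {i}. C t $ j $ p j)))
     = (\<Sum>i\<in>UNIV. \<Sum>p\<in>?S. of_int (sign p) * ((A ** C t) $ i $ p i * (\<Prod>j\<in>UNIV - {i}. C t $ j $ p j)))"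
    by (simp add: sum_distrib_left sum.swap[of _ UNIV])
  also have "\<dots> = (\<Sum>i\<in>UNIV. det (?R i ((A ** C t) $ i)))"
  proof (rule sum.cong[OF refl])
    fix i
    have "(\<Prod>j\<in>UNIV. ?R i ((A ** C t) $ i) $ j $ p j) =
        (A ** C t) $ i $ p i * (\<Prod>j\<in>UNIV - {i}. C t $ j $ p j)" for p
      by (subst prod.remove[of _ i]) auto
    then show "(\<Sum>p\<in>?S. of_int (sign p) * ((A ** C t) $ i $ p i * (\<Prod>j\<in>UNIV - {i}. C t $ j $ p j)))
        = det (?R i ((A ** C t) $ i))"
      by (simp add: det_def)
  qed
  also have "\<dots> = trace A * det (C t)"
    by (simp add: row trace_def sum_distrib_right)
  finally show ?thesis by (simp add: det_def)
qed

section \<open>Alternating forms\<close>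

abbreviation basis_list :: "'m::finite list \<Rightarrow> (real^'m) list" where
  "basis_list js \<equiv> map (\<lambda>k. axis k 1) js"

lemma alternating_formD:
  assumes "alternating_form k w"
  shows alternating_form_length: "length vs \<noteq> k \<Longrightarrow> w vs = 0"
    and alternating_form_linear: "length vs = k \<Longrightarrow> i < k \<Longrightarrow> linear (\<lambda>v. w (vs[i := v]))"
    and alternating_form_repeated: "length vs = k \<Longrightarrow> i < j \<Longrightarrow> j < k \<Longrightarrow> vs ! i = vs ! j \<Longrightarrow> w vs = 0"
  using assms unfolding alternating_form_def by blast+

lemma alternating_form_add:
  assumes "alternating_form k w" "alternating_form k w'"
  shows "alternating_form k (\<lambda>vs. w vs + w' vs)"
  unfolding alternating_form_def
  by (auto simp: alternating_formD[OF assms(1)] alternating_formD[OF assms(2)] intro!: linear_compose_add)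

lemma alternating_form_scale:
  assumes "alternating_form k w"
  shows "alternating_form k (\<lambda>vs. c * w vs)"
  using linear_compose_scale_right[OF alternating_form_linear[OF assms], of _ _ c]
  unfolding alternating_form_def by (auto simp: alternating_formD[OF assms])

lemma alternating_form_sum:
  assumes "\<And>i. i \<in> I \<Longrightarrow> alternating_form k (w i)"
  shows "alternating_form k (\<lambda>vs. \<Sum>i\<in>I. w i vs)"
  using assms
proof (induction I rule: infinite_finite_induct)
  case (insert i I)
  then show ?case by (simp add: alternating_form_add)
qed (auto simp: alternating_form_def linear_zero)

lemma alternating_form_Cons:
  assumes "alternating_form (Suc k) w"
  shows "alternating_form k (\<lambda>vs. w (u # vs))"
proof -
  have "linear (\<lambda>v. w (u # vs[i := v]))" if "length vs = k" "i < k" for vs i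
    using alternating_form_linear[OF assms, of "u # vs" "Suc i"] that by simp
  moreover have "w (u # vs) = 0" if "length vs = k" "i < j" "j < k" "vs ! i = vs ! j" for vs i j
    using alternating_form_repeated[OF assms, of "u # vs" "Suc i" "Suc j"] that by simp
  ultimately show ?thesis
    using alternating_form_length[OF assms, of "u # _"] by (auto simp: alternating_form_def)
qed

text \<open>Polarisation: the form vanishes with \<open>vs ! i + vs ! j\<close> in both slots, and
  expanding leaves the two mixed terms.\<close>

lemma alternating_form_swap:
  assumes w: "alternating_form k w" and vs: "length vs = k" and ij: "i < j" "j < k"
  shows "w (vs[i := vs ! j, j := vs ! i]) = - w vs"
proof -
  let ?f = "\<lambda>a b. w (vs[i := a, j := b])"
  have l: "linear (\<lambda>a. ?f a b)" for b
    using alternating_form_linear[OF w, of "vs[j := b]" i] vs ij by (simp add: list_update_swap)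
  have r: "linear (\<lambda>b. ?f a b)" for a
    using alternating_form_linear[OF w, of "vs[i := a]" j] vs ij by simp
  have z: "?f a a = 0" for a
    using alternating_form_repeated[OF w, of "vs[i := a, j := a]" i j] vs ij by simp
  have "0 = ?f (vs ! i + vs ! j) (vs ! i + vs ! j)" by (simp only: z)
  also have "\<dots> = ?f (vs ! i) (vs ! i) + ?f (vs ! i) (vs ! j) + (?f (vs ! j) (vs ! i) + ?f (vs ! j) (vs ! j))"
    by (simp only: linear_add[OF l] linear_add[OF r])
  finally have "0 = ?f (vs ! i) (vs ! j) + ?f (vs ! j) (vs ! i)" by (simp only: z add_0_left add_0_right)
  then show ?thesis by simp
qed

text \<open>One adjacent swap for each entry of \<open>xs\<close>. For lists of the wrong length
  both sides vanish.\<close>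

lemma alternating_form_move:
  assumes w: "alternating_form k w"
  shows "w (us @ y # xs @ zs) = (-1) ^ length xs * w (us @ xs @ y # zs)"
proof (induction xs arbitrary: us)
  case (Cons x xs)
  let ?vs = "us @ y # x # xs @ zs"
  have "w ?vs = - w (us @ x # y # xs @ zs)"
  proof (cases "length ?vs = k")
    case True
    have "w (?vs[length us := ?vs ! Suc (length us), Suc (length us) := ?vs ! length us]) = - w ?vs"
      by (rule alternating_form_swap[OF w True]) (use True in auto)
    moreover have "?vs[length us := ?vs ! Suc (length us), Suc (length us) := ?vs ! length us]
        = us @ x # y # xs @ zs"
      by (simp add: nth_append list_update_append)
    ultimately show ?thesis by simp
  qed (simp add: alternating_form_length[OF w])
  with Cons[of "us @ [x]"] show ?case by simp
qed simp

text \<open>Absolute values avoid the sign of a permutation: the lemma only serves to transfer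
  vanishing to a sorted list. The prefix \<open>us\<close> absorbs the entries already matched in
  the induction.\<close>

lemma alternating_form_permute:
  assumes w: "alternating_form k w" and "mset vs = mset vs'"
  shows "\<bar>w (us @ vs)\<bar> = \<bar>w (us @ vs')\<bar>"
  using assms(2)
proof (induction vs arbitrary: us vs')
  case (Cons x r)
  then have "x \<in> set vs'" by (metis list.set_intros(1) set_mset_mset)
  then obtain xs zs where vs': "vs' = xs @ x # zs" by (meson split_list)
  with Cons.prems have "mset r = mset (xs @ zs)" by simp
  from Cons.IH[OF this, of "us @ [x]"] show ?case
    using alternating_form_move[OF w, of us x xs zs] by (simp add: vs' abs_mult power_abs)
qed simp

text \<open>A list of coordinate vectors either repeats an entry or can be sorted, and
  multilinearity reduces arbitrary vectors to coordinate vectors. With this, identities between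
  forms need checking on increasing index lists only.\<close>

lemma alternating_form_zero:
  fixes w :: "(real^'m::{finite,linorder}) list \<Rightarrow> real"
  assumes w: "alternating_form k w"
    and zero: "\<And>js. sorted_wrt (<) js \<Longrightarrow> length js = k \<Longrightarrow> w (basis_list js) = 0"
  shows "w vs = 0"
proof (cases "length vs = k")
  case True
  have basis: "w (basis_list js) = 0" if "length js = k" for js
  proof (cases "distinct js")
    case True
    have "\<bar>w ([] @ basis_list js)\<bar> = \<bar>w ([] @ basis_list (sort js))\<bar>"
      by (rule alternating_form_permute[OF w]) simp
    moreover have "w (basis_list (sort js)) = 0"
      by (rule zero) (use True that in \<open>auto simp: strict_sorted_iff\<close>)
    ultimately show ?thesis by simp
  next
    case False
    then obtain i j where "i < j" "j < length js" "js ! i = js ! j"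
      unfolding distinct_conv_nth by (metis linorder_neqE_nat)
    then show ?thesis
      using alternating_form_repeated[OF w, of "basis_list js" i j] that by simp
  qed
  \<comment> \<open>Here \<open>n\<close> counts the leading slots that may still hold arbitrary
    vectors; each induction step expands the last of them in the coordinate basis.\<close>
  have "w vs = 0" if "length vs = k" "n \<le> k" "\<And>i. n \<le> i \<Longrightarrow> i < k \<Longrightarrow> \<exists>j. vs ! i = axis j 1" for n vs
    using that
  proof (induction n arbitrary: vs)
    case 0
    then obtain f where f: "\<And>i. i < k \<Longrightarrow> vs ! i = axis (f i) 1" by (metis zero_le)
    have "vs = basis_list (map f [0..<k])" using 0 f by (auto intro: nth_equalityI)
    with basis[of "map f [0..<k]"] show ?case by simp
  next
    case (Suc n)
    let ?g = "\<lambda>v. w (vs[n := v])"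
    have lin: "linear ?g" using Suc.prems by (intro alternating_form_linear[OF w]) auto
    have z: "?g (axis l 1) = 0" for l
    proof (rule Suc.IH)
      fix i assume i: "n \<le> i" "i < k"
      show "\<exists>j. vs[n := axis l 1] ! i = axis j 1"
        using Suc.prems(1,2) Suc.prems(3)[of i] i by (cases "i = n") auto
    qed (use Suc.prems in auto)
    have "w vs = ?g (vs ! n)" by simp
    also have "vs ! n = (\<Sum>l\<in>UNIV. (vs ! n) $ l *\<^sub>R axis l 1)"
      using basis_expansion[of "vs ! n"] by (simp add: scalar_mult_eq_scaleR)
    also have "?g \<dots> = 0" by (simp add: linear_sum[OF lin] linear_cmul[OF lin] z)
    finally show ?case .
  qed
  from this[of vs k] True show ?thesis by simp
qed (simp add: alternating_form_length[OF w])

lemma alternating_form_eqI: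
  fixes w :: "(real^'m::{finite,linorder}) list \<Rightarrow> real"
  assumes "alternating_form k w" "alternating_form k w'"
    and "\<And>js. sorted_wrt (<) js \<Longrightarrow> length js = k \<Longrightarrow> w (basis_list js) = w' (basis_list js)"
  shows "w vs = w' vs"
  using alternating_form_zero[OF alternating_form_add[OF assms(1) alternating_form_scale[OF assms(2), of "-1"]], of vs]
    assms(3) by simp

text \<open>The zero-based place of \<open>i\<close> in the increasing enumeration of the index
  type. It mediates between list positions, on which forms act, and row indices, on which
  \<open>det\<close> acts.\<close>

abbreviation pos :: "'m::{finite,linorder} \<Rightarrow> nat" where
  "pos i \<equiv> card {..<i}"

abbreviation full_basis :: "(real^'m::{finite,linorder}) list" where
  "full_basis \<equiv> basis_list (sorted_list_of_set UNIV)"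

text \<open>The number of entries preceding \<open>j\<close> is recorded because it is the exponent
  of the sign for moving a coordinate vector to its place.\<close>

lemma sorted_list_of_set_split:
  fixes S :: "'m::linorder set"
  assumes "finite S" "j \<in> S"
  obtains xs zs where "sorted_list_of_set S = xs @ j # zs" "sorted_list_of_set (S - {j}) = xs @ zs"
    "length xs = card {x\<in>S. x < j}"
proof -
  obtain xs zs where s: "sorted_list_of_set S = xs @ j # zs"
    using assms by (metis set_sorted_list_of_set split_list)
  have "sorted_wrt (<) (xs @ j # zs)" using s by (metis strict_sorted_list_of_set)
  then have lt: "\<forall>x\<in>set xs. x < j" "\<forall>z\<in>set zs. j < z" "distinct (xs @ j # zs)"
    by (auto simp: sorted_wrt_append strict_sorted_iff)
  have "sorted_list_of_set (S - {j}) = xs @ zs"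
    using assms lt(3) by (simp add: sorted_list_of_set_remove s remove1_append)
  moreover have "set xs = {x\<in>S. x < j}"
  proof -
    have "S = set xs \<union> {j} \<union> set zs" using assms s by (metis set_sorted_list_of_set set_append list.simps(15) Un_insert_right insert_is_Un sup_assoc sup_commute)
    then show ?thesis using lt by force
  qed
  then have "length xs = card {x\<in>S. x < j}" using lt(3) by (metis distinct_append distinct_card)
  ultimately show ?thesis using that s by blast
qed

lemma sorted_length_CARD:
  fixes js :: "'m::{finite,linorder} list"
  assumes "sorted_wrt (<) js" "length js = CARD('m)"
  shows "js = sorted_list_of_set UNIV"
proof -
  have "distinct js" using assms by (simp add: strict_sorted_iff)
  then have "set js = UNIV" using assms by (metis card_subset_eq distinct_card finite subset_UNIV)
  then show ?thesis
    using assms sorted_list_of_set.idem_if_sorted_distinct by (metis strict_sorted_iff)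
qed

lemma nth_pos: "sorted_list_of_set UNIV ! pos i = (i::'m::{finite,linorder})"
proof -
  obtain xs zs where "sorted_list_of_set UNIV = xs @ i # zs" "sorted_list_of_set (UNIV - {i}) = xs @ zs"
    "length xs = card {x\<in>UNIV. x < i}"
    by (rule sorted_list_of_set_split[OF finite UNIV_I])
  then show ?thesis by (simp add: nth_append lessThan_def)
qed

lemma pos_less: "pos (i::'m::{finite,linorder}) < CARD('m)"
  by (rule psubset_card_mono) auto

lemma pos_inj: "pos i = pos j \<longleftrightarrow> i = (j::'m::{finite,linorder})"
  by (metis nth_pos)

lemma pos_surj:
  assumes "n < CARD('m::{finite,linorder})"
  obtains i :: "'m::{finite,linorder}" where "n = pos i"
proof -
  have "inj_on pos (UNIV::'m set)" by (simp add: inj_on_def pos_inj)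
  then have "card (pos ` (UNIV::'m set)) = card {..<CARD('m)}" by (simp add: card_image)
  then have "pos ` (UNIV::'m set) = {..<CARD('m)}"
    by (intro card_subset_eq) (auto simp: pos_less)
  with assms that show ?thesis by auto
qed

lemma alternating_form_det:
  "alternating_form CARD('m::{finite,linorder})
    (\<lambda>vs :: (real^'m::{finite,linorder}) list. if length vs = CARD('m) then det (\<chi> i. vs ! pos i) else 0)"
  unfolding alternating_form_def
proof (intro conjI allI impI)
  fix vs :: "(real, 'm) vec list" and n assume a: "length vs = CARD('m) \<and> n < CARD('m)"
  then obtain k :: 'm where n: "n = pos k" using pos_surj by auto
  have eq: "(\<chi> i. vs[n := v] ! pos i) = (\<chi> i. if i = k then v else vs ! pos i)" for v
    using a by (auto simp: vec_eq_iff n pos_inj nth_list_update)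
  have "linear (\<lambda>v. det (\<chi> i. if i = k then v else vs ! pos i))"
    by (rule linearI)
      (simp_all add: det_row_add[of k "\<lambda>_. _" "\<lambda>_. _"] det_row_mul[of k _ "\<lambda>_. _"] scalar_mult_eq_scaleR[symmetric] cong: if_cong)
  then show "linear (\<lambda>v. if length (vs[n := v]) = CARD('m) then det (\<chi> i. vs[n := v] ! pos i) else 0)"
    using a by (simp add: eq)
next
  fix vs :: "(real, 'm) vec list" and n p assume a: "length vs = CARD('m) \<and> n < p \<and> p < CARD('m) \<and> vs ! n = vs ! p"
  then obtain k l :: 'm where "n = pos k" "p = pos l" using pos_surj by (metis less_trans)
  with a show "(if length vs = CARD('m) then det (\<chi> i. vs ! pos i) else 0) = 0"
    by (auto simp: row_def intro!: det_identical_rows[of k l])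
qed simp

text \<open>Top-degree forms are a one-dimensional space: both sides are alternating, and the only
  increasing list of full length is that of all indices, where the matrix is the identity.\<close>

lemma top_form_eq_det:
  fixes w :: "(real^'m::{finite,linorder}) list \<Rightarrow> real"
  assumes w: "alternating_form CARD('m) w" and "length vs = CARD('m)"
  shows "w vs = w full_basis * det (\<chi> i. vs ! pos i)"
proof -
  have "w vs = w full_basis * (if length vs = CARD('m) then det (\<chi> i. vs ! pos i) else 0)"
  proof (rule alternating_form_eqI[OF w alternating_form_scale[OF alternating_form_det]])
    fix js :: "'m list" assume "sorted_wrt (<) js" "length js = CARD('m)"
    then have js: "js = sorted_list_of_set UNIV" by (rule sorted_length_CARD)
    have "(\<chi> i::'m. full_basis ! pos i) = mat 1"
      by (simp add: vec_eq_iff nth_pos pos_less mat_def axis_def)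
    then show "w (basis_list js) =
      w full_basis * (if length (basis_list js) = CARD('m) then det (\<chi> i. basis_list js ! pos i) else 0)"
      by (simp add: js)
  qed
  then show ?thesis by (simp add: assms(2))
qed

text \<open>The arguments are the rows of the matrix in \<open>top_form_eq_det\<close>, so applying
  \<open>C\<close> to each of them is right multiplication by \<open>transpose C\<close>.\<close>

lemma top_form_map:
  fixes w :: "(real^'m::{finite,linorder}) list \<Rightarrow> real"
  assumes w: "alternating_form CARD('m) w"
  shows "w (map (\<lambda>v. C *v v) vs) = det C * w vs"
proof (cases "length vs = CARD('m)")
  case True
  have "(\<chi> i::'m. map (\<lambda>v. C *v v) vs ! pos i) = (\<chi> i. vs ! pos i) ** transpose C"
    using True by (simp add: vec_eq_iff matrix_vector_mult_def matrix_matrix_mult_def transpose_def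
        pos_less mult.commute)
  then show ?thesis
    using top_form_eq_det[OF w, of vs] top_form_eq_det[OF w, of "map (\<lambda>v. C *v v) vs"] True
    by (simp add: det_mul)
qed (simp add: alternating_form_length[OF w])

text \<open>\<open>volume_form\<close> only provides some list with nonzero value; this moves it to
  the coordinate basis, making the density a legitimate denominator.\<close>

lemma top_form_full_basis_nonzero:
  fixes w :: "(real^'m::{finite,linorder}) list \<Rightarrow> real"
  assumes "alternating_form CARD('m) w" "w vs \<noteq> 0"
  shows "w full_basis \<noteq> 0"
proof -
  have "length vs = CARD('m)" using assms alternating_form_length by blast
  from top_form_eq_det[OF assms(1) this] assms(2) show ?thesis by auto
qed

text \<open>The sign for moving the coordinate vector \<open>i\<close> from the front to its place
  in \<open>full_basis\<close>.\<close>

definition eps :: "'m::{finite,linorder} \<Rightarrow> real" where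
  "eps i = (-1) ^ pos i"

lemma eps_nonzero [simp]: "eps i \<noteq> 0" and eps_mult_self [simp]: "eps i * eps i = 1"
  by (simp_all add: eps_def power_mult_distrib[symmetric] mult.assoc[symmetric])

text \<open>Deleting \<open>i\<close> lowers the place of \<open>j\<close> by one exactly when
  \<open>i < j\<close>.\<close>

lemma sign_omit:
  fixes i j :: "'m::{finite,linorder}"
  assumes "i \<noteq> j"
  shows "(-1) ^ card {x \<in> - {i}. x < j} = (if i < j then - eps j else eps j)"
proof (cases "i < j")
  case True
  then have "{..<j} = insert i {x \<in> - {i}. x < j}" by auto
  then have "pos j = Suc (card {x \<in> - {i}. x < j})" by (metis (no_types, lifting) ComplD card_insert_disjoint finite insertI1 mem_Collect_eq)
  with True show ?thesis by (simp add: eps_def)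
next
  case False
  then have "{x \<in> - {i}. x < j} = {..<j}" by auto
  with False show ?thesis by (simp add: eps_def)
qed

section \<open>Contractions of a top-degree form with coordinate vectors\<close>

lemma top_form_omit:
  fixes w :: "(real^'m::{finite,linorder}) list \<Rightarrow> real"
  assumes w: "alternating_form CARD('m) w"
  shows "w (axis i 1 # basis_list (sorted_list_of_set (- {i}))) = eps i * w full_basis"
proof -
  obtain xs zs where "sorted_list_of_set UNIV = xs @ i # zs" "sorted_list_of_set (UNIV - {i}) = xs @ zs"
    "length xs = card {x\<in>UNIV. x < i}"
    by (rule sorted_list_of_set_split[OF finite UNIV_I])
  then show ?thesis
    using alternating_form_move[OF w, of "[]" "axis i 1" "basis_list xs" "basis_list zs"]
    by (simp add: Compl_eq_Diff_UNIV eps_def lessThan_def)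
qed

lemma top_form_omit_other:
  fixes w :: "(real^'m::{finite,linorder}) list \<Rightarrow> real"
  assumes w: "alternating_form CARD('m) w" and "l \<noteq> i"
  shows "w (axis l 1 # basis_list (sorted_list_of_set (- {i}))) = 0"
proof -
  have "l \<in> - {i}" using assms by simp
  then obtain xs zs where s: "sorted_list_of_set (- {i}) = xs @ l # zs"
    by (rule sorted_list_of_set_split[OF finite])
  let ?vs = "axis l 1 # basis_list (sorted_list_of_set (- {i}))"
  have "length ?vs = CARD('m)" by (simp add: Compl_eq_Diff_UNIV)
  moreover have "Suc (length xs) < length ?vs" "?vs ! 0 = ?vs ! Suc (length xs)"
    by (simp_all add: s nth_append)
  ultimately show ?thesis
    using alternating_form_repeated[OF w, of ?vs 0 "Suc (length xs)"] by simp
qed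

lemma card_omit2:
  fixes i j :: "'m::finite"
  assumes "i \<noteq> j"
  shows "Suc (Suc (card (- {i, j}))) = CARD('m)"
proof -
  have "card (insert i (insert j (- {i, j}))) = Suc (Suc (card (- {i, j})))"
    using assms by simp
  moreover have "insert i (insert j (- {i, j})) = UNIV" by auto
  ultimately show ?thesis by simp
qed

text \<open>The vector \<open>j\<close> is moved first, past entries from which \<open>i\<close> is
  already missing; this is the source of the extra sign when \<open>i < j\<close>.\<close>

lemma top_form_omit2:
  fixes w :: "(real^'m::{finite,linorder}) list \<Rightarrow> real"
  assumes w: "alternating_form CARD('m) w" and ij: "i \<noteq> j"
  shows "w (axis i 1 # axis j 1 # basis_list (sorted_list_of_set (- {i, j}))) =
    (if i < j then -1 else 1) * eps i * eps j * w full_basis"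
proof -
  have "j \<in> - {i}" using ij by simp
  then obtain xs zs where s: "sorted_list_of_set (- {i}) = xs @ j # zs" "sorted_list_of_set (- {i} - {j}) = xs @ zs"
    "length xs = card {x\<in>- {i}. x < j}"
    by (rule sorted_list_of_set_split[OF finite])
  have "- {i} - {j} = - {i, j}" by auto
  with s(2) have c: "sorted_list_of_set (- {i, j}) = xs @ zs" by (simp only:)
  have "w (axis i 1 # axis j 1 # basis_list (sorted_list_of_set (- {i, j}))) =
      (-1) ^ length xs * w (axis i 1 # basis_list (sorted_list_of_set (- {i})))"
    using alternating_form_move[OF w, of "[axis i 1]" "axis j 1" "basis_list xs" "basis_list zs"]
    by (simp add: c s(1))
  also have "\<dots> = (if i < j then - eps j else eps j) * (eps i * w full_basis)"
    by (simp only: s(3) sign_omit[OF ij] top_form_omit[OF w])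
  finally show ?thesis by simp
qed

text \<open>Only \<open>i\<close> and \<open>j\<close> are absent from the tail, so unless
  \<open>k\<close> and \<open>l\<close> supply exactly these, some coordinate vector occurs
  twice.\<close>

lemma top_form_omit2_other:
  fixes w :: "(real^'m::{finite,linorder}) list \<Rightarrow> real"
  assumes w: "alternating_form CARD('m) w" and ij: "i \<noteq> j" and kl: "{k, l} \<noteq> {i, j}"
  shows "w (axis k 1 # axis l 1 # basis_list (sorted_list_of_set (- {i, j}))) = 0"
proof -
  let ?js = "sorted_list_of_set (- {i, j})"
  let ?vs = "basis_list (k # l # ?js)"
  have len: "length ?vs = CARD('m)"
    using card_omit2[OF ij] by (simp del: Compl_insert)
  have "\<not> distinct (k # l # ?js)" using kl by auto
  then obtain p q where pq: "p < q" "q < length (k # l # ?js)" "(k # l # ?js) ! p = (k # l # ?js) ! q"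
    unfolding distinct_conv_nth by (metis linorder_neqE_nat)
  have "?vs ! p = ?vs ! q"
    by (simp only: nth_map[OF pq(2)] nth_map[OF less_trans[OF pq(1,2)]] pq(3))
  moreover have "q < CARD('m)" using pq(2) len by (simp only: length_map)
  ultimately have "w ?vs = 0" using alternating_form_repeated[OF w len pq(1)] by blast
  then show ?thesis by simp
qed

lemma alternating_form_expand:
  fixes w :: "(real^'m::finite) list \<Rightarrow> real"
  assumes w: "alternating_form k w"
  shows "w (v # vs) = (\<Sum>i\<in>UNIV. v $ i * w (axis i 1 # vs))"
proof (cases "Suc (length vs) = k")
  case True
  then have lin: "linear (\<lambda>v. w (v # vs))"
    using alternating_form_linear[OF w, of "v # vs" 0] by force
  have "w (v # vs) = w ((\<Sum>i\<in>UNIV. v $ i *\<^sub>R axis i 1) # vs)"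
    using basis_expansion[of v] by (simp add: scalar_mult_eq_scaleR)
  also have "\<dots> = (\<Sum>i\<in>UNIV. v $ i * w (axis i 1 # vs))"
    by (simp add: linear_sum[OF lin] linear_cmul[OF lin])
  finally show ?thesis .
qed (simp add: alternating_form_length[OF w])

lemma alternating_form_expand2:
  fixes w :: "(real^'m::finite) list \<Rightarrow> real"
  assumes w: "alternating_form (Suc k) w"
  shows "w (u # v # vs) = (\<Sum>i\<in>UNIV. \<Sum>j\<in>UNIV. u $ i * v $ j * w (axis i 1 # axis j 1 # vs))"
proof -
  have "w (axis i 1 # v # vs) = (\<Sum>j\<in>UNIV. v $ j * w (axis i 1 # axis j 1 # vs))" for i
    by (rule alternating_form_expand[OF alternating_form_Cons[OF w]])
  then show ?thesis
    by (simp add: alternating_form_expand[OF w, of u] sum_distrib_left mult.assoc)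
qed

text \<open>Only the index pairs \<open>(i, j)\<close> and \<open>(j, i)\<close> survive. Both
  \<open>p\<close> and the form change sign under the exchange, so they contribute equally, whence
  the factor 2.\<close>

lemma contraction_basis:
  fixes w :: "(real^'m::{finite,linorder}) list \<Rightarrow> real" and p :: "'m \<Rightarrow> 'm \<Rightarrow> real"
  assumes w: "alternating_form CARD('m) w" and "i < j" and p: "\<And>i j. p i j = - p j i"
  shows "(\<Sum>k\<in>UNIV. \<Sum>l\<in>UNIV. p k l * w (axis k 1 # axis l 1 # basis_list (sorted_list_of_set (- {i, j})))) =
    - 2 * eps i * eps j * p i j * w full_basis"
proof -
  let ?f = "\<lambda>k l. p k l * w (axis k 1 # axis l 1 # basis_list (sorted_list_of_set (- {i, j})))"
  have ij: "i \<noteq> j" "j \<noteq> i" using \<open>i < j\<close> by auto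
  have c: "{i, j} = {j, i}" by auto
  have "(\<Sum>k\<in>UNIV. \<Sum>l\<in>UNIV. ?f k l) = (\<Sum>(k,l)\<in>UNIV \<times> UNIV. ?f k l)"
    by (rule sum.cartesian_product)
  also have "\<dots> = (\<Sum>(k,l)\<in>{(i,j),(j,i)}. ?f k l)"
  proof (rule sum.mono_neutral_right)
    show "\<forall>x\<in>UNIV \<times> UNIV - {(i,j),(j,i)}. (case x of (k,l) \<Rightarrow> ?f k l) = 0"
    proof
      fix x assume x: "x \<in> UNIV \<times> UNIV - {(i,j),(j,i)}"
      obtain k l where xkl: "x = (k, l)" by (cases x)
      with x have "k = l \<or> {k, l} \<noteq> {i, j}" by (auto simp: doubleton_eq_iff)
      then have "?f k l = 0"
      proof
        assume "k = l"
        then have "p k l = 0" using p[of k l] by simp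
        then show ?thesis by simp
      next
        assume kl: "{k, l} \<noteq> {i, j}"
        show ?thesis by (simp only: top_form_omit2_other[OF w ij(1) kl] mult_zero_right)
      qed
      then show "(case x of (k, l) \<Rightarrow> ?f k l) = 0" by (simp add: xkl)
    qed
  qed auto
  also have "\<dots> = ?f i j + ?f j i" using ij by simp
  also have "\<dots> = - 2 * eps i * eps j * p i j * w full_basis"
    using top_form_omit2[OF w ij(1)] top_form_omit2[OF w ij(2)] \<open>i < j\<close> p[of j i]
    by (simp only: c) (simp add: not_less_iff_gr_or_eq)
  finally show ?thesis .
qed

text \<open>A skew array can be read off from its contraction with a nonzero top-degree form, one
  entry from each list omitting two indices. This identifies chart representatives of the dual
  bivector.\<close>

lemma contraction_inject:
  fixes w :: "(real^'m::{finite,linorder}) list \<Rightarrow> real" and p q :: "'m \<Rightarrow> 'm \<Rightarrow> real"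
  assumes w: "alternating_form CARD('m) w" "w full_basis \<noteq> 0"
    and p: "\<And>i j. p i j = - p j i" and q: "\<And>i j. q i j = - q j i"
    and eq: "\<And>vs. (\<Sum>k\<in>UNIV. \<Sum>l\<in>UNIV. p k l * w (axis k 1 # axis l 1 # vs)) =
      (\<Sum>k\<in>UNIV. \<Sum>l\<in>UNIV. q k l * w (axis k 1 # axis l 1 # vs))"
  shows "p i j = q i j"
proof -
  have less: "p i j = q i j" if "i < j" for i j
    using eq[of "basis_list (sorted_list_of_set (- {i, j}))"] w(2)
    unfolding contraction_basis[OF w(1) that p] contraction_basis[OF w(1) that q] by simp
  consider "i < j" | "i = j" | "j < i" by (rule linorder_cases)
  then show ?thesis
  proof cases
    case 2
    then show ?thesis using p[of i i] q[of i i] by simp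
  next
    case 3
    then show ?thesis using less[of j i] p[of i j] q[of i j] by simp
  qed (rule less)
qed

section \<open>Divergence-free bivectors of rank two\<close>

lemma coeff_matrix_skew: "coeff_matrix \<omega> c x $ i $ j = - coeff_matrix \<omega> c x $ j $ i"
  by (auto simp: coeff_matrix_def)

lemma coeff_matrix_eq:
  "i \<noteq> j \<Longrightarrow> coeff_matrix \<omega> c x $ i $ j =
    (if i < j then 1 else -1) * \<omega> c x (basis_list (sorted_list_of_set (- {i, j})))"
  by (auto simp: coeff_matrix_def insert_commute)

lemma sum_nth_sorted_list_of_set:
  assumes "finite S"
  shows "(\<Sum>n<length (sorted_list_of_set S). f (sorted_list_of_set S ! n)) = sum f S"
proof -
  have "sum f S = sum_list (map f (sorted_list_of_set S))"
    using assms sum_list_distinct_conv_sum_set[of "sorted_list_of_set S" f] by simp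
  also have "\<dots> = (\<Sum>n<length (sorted_list_of_set S). f (sorted_list_of_set S ! n))"
    by (simp add: sum_list_sum_nth atLeast0LessThan)
  finally show ?thesis by simp
qed

section \<open>Partial derivatives and the exterior derivative in coordinates\<close>

lemma partial_cmult:
  assumes "f differentiable (at x)"
  shows "partial j (\<lambda>y. r * f y) x = r * partial j f x"
proof -
  have "((\<lambda>y. r * f y) has_derivative (\<lambda>v. r * frechet_derivative f (at x) v)) (at x)"
    using assms by (auto intro!: derivative_eq_intros simp: frechet_derivative_works)
  then show ?thesis
    unfolding partial_def by (simp only: frechet_derivative_at[symmetric])
qed

lemma partial_mult:
  assumes "f differentiable (at x)" "g differentiable (at x)"
  shows "partial j (\<lambda>y. f y * g y) x = partial j f x * g x + f x * partial j g x"
proof -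
  have "((\<lambda>y. f y * g y) has_derivative
      (\<lambda>v. f x * frechet_derivative g (at x) v + frechet_derivative f (at x) v * g x)) (at x)"
    using assms by (auto intro!: derivative_eq_intros simp: frechet_derivative_works)
  then have "frechet_derivative (\<lambda>y. f y * g y) (at x) =
      (\<lambda>v. f x * frechet_derivative g (at x) v + frechet_derivative f (at x) v * g x)"
    by (rule frechet_derivative_at[symmetric])
  then show ?thesis by (simp add: partial_def)
qed

lemma partial_add:
  assumes "f differentiable (at x)" "g differentiable (at x)"
  shows "partial j (\<lambda>y. f y + g y) x = partial j f x + partial j g x"
proof -
  have "((\<lambda>y. f y + g y) has_derivative
      (\<lambda>v. frechet_derivative f (at x) v + frechet_derivative g (at x) v)) (at x)"
    using assms by (auto intro!: derivative_eq_intros simp: frechet_derivative_works)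
  then have "frechet_derivative (\<lambda>y. f y + g y) (at x) =
      (\<lambda>v. frechet_derivative f (at x) v + frechet_derivative g (at x) v)"
    by (rule frechet_derivative_at[symmetric])
  then show ?thesis by (simp add: partial_def)
qed

lemma partial_sum:
  assumes "\<And>i. i \<in> I \<Longrightarrow> f i differentiable (at x)"
  shows "partial j (\<lambda>y. \<Sum>i\<in>I. f i y) x = (\<Sum>i\<in>I. partial j (f i) x)"
  using assms
proof (induction I rule: infinite_finite_induct)
  case (insert i I)
  then show ?case by (simp add: partial_add differentiable_sum)
qed (auto simp: partial_def)

lemma partial_cong_open:
  assumes "open S" "x \<in> S" "\<And>y. y \<in> S \<Longrightarrow> f y = g y" "f differentiable (at x)"
  shows "partial j f x = partial j g x"
  using frechet_derivative_transform_within_open[OF assms(4,1,2,3)] by (simp add: partial_def)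

text \<open>The summand that drops \<open>j\<close> carries the sign of the place of
  \<open>j\<close> among the indices other than \<open>i\<close>. Its dependence on whether
  \<open>i < j\<close> cancels against the sign convention of \<open>coeff_matrix\<close>, leaving
  the uniform factor \<open>eps j\<close>.\<close>

lemma ext_deriv_omit:
  fixes \<omega> :: "('a, 'm::{finite,linorder}) form"
  assumes diff: "\<And>vs. (\<lambda>y. \<omega> c y vs) differentiable (at x)"
  shows "ext_deriv \<omega> c x (basis_list (sorted_list_of_set (- {i}))) =
    (\<Sum>j\<in>UNIV. eps j * partial j (\<lambda>y. coeff_matrix \<omega> c y $ j $ i) x)"
proof -
  let ?L = "sorted_list_of_set (- {i})"
  let ?g = "\<lambda>j. eps j * partial j (\<lambda>y. coeff_matrix \<omega> c y $ j $ i) x"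
  have "(-1) ^ n * frechet_derivative (\<lambda>y. \<omega> c y (take n (basis_list ?L) @ drop (Suc n) (basis_list ?L)))
      (at x) (basis_list ?L ! n) = ?g (?L ! n)" if n: "n < length ?L" for n
  proof -
    define j where "j = ?L ! n"
    have j: "j \<in> - {i}" using n by (metis j_def finite nth_mem set_sorted_list_of_set)
    then have ij: "i \<noteq> j" "j \<noteq> i" by auto
    obtain xs zs where s: "?L = xs @ j # zs" "sorted_list_of_set (- {i} - {j}) = xs @ zs"
      "length xs = card {x\<in>- {i}. x < j}"
      using j by (rule sorted_list_of_set_split[OF finite])
    have "distinct ?L" by simp
    moreover have "length xs < length ?L" by (subst s(1)) simp
    moreover have "?L ! length xs = ?L ! n" unfolding j_def[symmetric] by (subst s(1)) simp
    ultimately have len: "length xs = n" using n nth_eq_iff_index_eq by blast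
    have "- {i} - {j} = - {i, j}" by auto
    with s(2) have "sorted_list_of_set (- {i, j}) = xs @ zs" by (simp only:)
    then have td: "take n (basis_list ?L) @ drop (Suc n) (basis_list ?L) = basis_list (sorted_list_of_set (- {i, j}))"
      using len by (simp add: s(1))
    have "coeff_matrix \<omega> c y $ j $ i =
        (if i < j then -1 else 1) * \<omega> c y (basis_list (sorted_list_of_set (- {i, j})))" for y
      using coeff_matrix_eq[OF ij(2), of \<omega> c y] ij by (auto simp: insert_commute)
    then have "?g j = eps j * ((if i < j then -1 else 1) *
        partial j (\<lambda>y. \<omega> c y (basis_list (sorted_list_of_set (- {i, j})))) x)"
      by (simp only: partial_cmult[OF diff])
    also have "\<dots> = (-1) ^ n * partial j (\<lambda>y. \<omega> c y (basis_list (sorted_list_of_set (- {i, j})))) x"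
      using sign_omit[OF ij(1)] unfolding s(3)[symmetric] len by simp
    finally show ?thesis
      using n unfolding td by (simp add: partial_def j_def)
  qed
  then have "ext_deriv \<omega> c x (basis_list ?L) = (\<Sum>n<length ?L. ?g (?L ! n))"
    unfolding ext_deriv_def length_map by (intro sum.cong) auto
  also have "\<dots> = sum ?g (- {i})"
    by (rule sum_nth_sorted_list_of_set) simp
  \<comment> \<open>The added term \<open>j = i\<close> is zero because the diagonal of
    \<open>coeff_matrix\<close> is.\<close>
  also have "\<dots> = sum ?g UNIV"
    by (rule sum.mono_neutral_left) (auto simp: coeff_matrix_def partial_def)
  finally show ?thesis .
qed

text \<open>If \<open>R\<^sub>i\<^sub>j \<noteq> 0\<close>, rows \<open>i\<close> and \<open>j\<close> span the row space; the relation comes from expanding row \<open>k\<close> in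
  them and reading off the coefficients at the columns \<open>i\<close> and \<open>j\<close>.\<close>

lemma skew_rank2_plucker_aux:
  fixes R :: "real^'n::finite^'n"
  assumes skew: "\<And>i j. R $ i $ j = - R $ j $ i" and "rank R \<le> 2" and nz: "R $ i $ j \<noteq> 0"
  shows "R $ i $ j * R $ k $ l + R $ j $ k * R $ i $ l + R $ k $ i * R $ j $ l = 0"
proof -
  have diag: "R $ p $ p = 0" for p using skew[of p p] by simp
  have j0: "R $ j \<noteq> 0" using nz skew[of i j] by (auto simp: vec_eq_iff)
  have notin: "R $ i \<notin> span {R $ j}"
  proof
    assume "R $ i \<in> span {R $ j}"
    then obtain c where "R $ i = c *\<^sub>R R $ j" by (auto simp: span_singleton)
    then have "R $ i $ j = c * R $ j $ j" by simp
    with nz diag show False by simp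
  qed
  have ne: "R $ i \<noteq> R $ j" using notin span_base by force
  have ind: "independent {R $ i, R $ j}"
    using notin j0 ne by (simp add: independent_insert)
  have row: "R $ p \<in> rows R" for p by (auto simp: rows_def row_def)
  have "rows R \<subseteq> span {R $ i, R $ j}"
  proof (rule card_ge_dim_independent[OF _ ind])
    show "dim (rows R) \<le> card {R $ i, R $ j}"
      using \<open>rank R \<le> 2\<close> ne by (simp add: row_rank_def)
  qed (use row in auto)
  then have "R $ k \<in> span {R $ i, R $ j}" using row by blast
  then obtain \<alpha> where "R $ k - \<alpha> *\<^sub>R R $ i \<in> span {R $ j}"
    by (auto simp: span_breakdown_eq)
  then obtain \<beta> where "R $ k - \<alpha> *\<^sub>R R $ i = \<beta> *\<^sub>R R $ j" by (auto simp: span_singleton)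
  then have comp: "R $ k $ p = \<alpha> * R $ i $ p + \<beta> * R $ j $ p" for p
    by (metis add.commute diff_eq_eq vector_add_component vector_scaleR_component real_scaleR_def)
  have "R $ k $ i = - \<beta> * R $ i $ j" "R $ j $ k = - \<alpha> * R $ i $ j"
    using comp[of i] comp[of j] skew[of j i] skew[of j k] diag by simp_all
  then show ?thesis by (simp add: comp[of l] algebra_simps)
qed

text \<open>The relation is invariant under cyclic permutation of \<open>i\<close>,
  \<open>j\<close>, \<open>k\<close>, so one nonzero entry among the three leading factors suffices;
  if all three vanish, so does every summand.\<close>

lemma skew_rank2_plucker:
  fixes R :: "real^'n::finite^'n"
  assumes skew: "\<And>i j. R $ i $ j = - R $ j $ i" and "rank R \<le> 2"
  shows "R $ i $ j * R $ k $ l + R $ j $ k * R $ i $ l + R $ k $ i * R $ j $ l = 0"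
proof -
  note aux = skew_rank2_plucker_aux[OF assms]
  consider "R $ i $ j \<noteq> 0" | "R $ j $ k \<noteq> 0" | "R $ k $ i \<noteq> 0" | "R $ i $ j = 0" "R $ j $ k = 0" "R $ k $ i = 0"
    by blast
  then show ?thesis
    by cases (use aux[of i j k l] aux[of j k i l] aux[of k i j l] in simp_all)
qed

text \<open>Contract the derivative of the Pluecker relation for \<open>\<pi>\<close> and \<open>w\<pi>\<close> in the index \<open>l\<close>: the terms in which
  \<open>w\<pi>\<close> is differentiated vanish, and what remains is \<open>w\<close> times half the bracket.\<close>

lemma schouten_self_zero:
  fixes \<pi> :: "('a, 'm::finite) bivector"
  assumes "open S" "x \<in> S" and w: "w differentiable (at x)" "w x \<noteq> 0"
    and diff: "\<And>i j. (\<lambda>y. \<pi> c y $ i $ j) differentiable (at x)"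
    and plucker: "\<And>y i j k l. y \<in> S \<Longrightarrow>
      \<pi> c y $ i $ j * \<pi> c y $ k $ l + \<pi> c y $ j $ k * \<pi> c y $ i $ l + \<pi> c y $ k $ i * \<pi> c y $ j $ l = 0"
    and div: "\<And>k. (\<Sum>l\<in>UNIV. partial l (\<lambda>y. w y * \<pi> c y $ k $ l) x) = 0"
  shows "schouten \<pi> \<pi> c x i j k = 0"
proof -
  define P where "P = \<pi> c"
  define T where "T = (\<lambda>i j k. \<Sum>l\<in>UNIV. P x $ k $ l * partial l (\<lambda>y. P y $ i $ j) x)"
  note diff' = diff[folded P_def]
  have dQ: "(\<lambda>y. w y * P y $ k $ l) differentiable (at x)" for k l
    by (rule differentiable_mult[OF w(1) diff'])
  have dPQ: "(\<lambda>y. P y $ i $ j * (w y * P y $ k $ l)) differentiable (at x)" for i j k l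
    by (rule differentiable_mult[OF diff' dQ])
  have T: "(\<Sum>l\<in>UNIV. partial l (\<lambda>y. P y $ i $ j * (w y * P y $ k $ l)) x) = w x * T i j k" for i j k
  proof -
    have "(\<Sum>l\<in>UNIV. partial l (\<lambda>y. P y $ i $ j * (w y * P y $ k $ l)) x) =
       (\<Sum>l\<in>UNIV. partial l (\<lambda>y. P y $ i $ j) x * (w x * P x $ k $ l)) +
       P x $ i $ j * (\<Sum>l\<in>UNIV. partial l (\<lambda>y. w y * P y $ k $ l) x)"
      by (simp add: partial_mult[OF diff' dQ] sum.distrib sum_distrib_left)
    then show ?thesis
      by (simp add: div[folded P_def] T_def sum_distrib_left mult_ac)
  qed
  \<comment> \<open>The density multiplies the factor carrying \<open>l\<close>, since it is this
    factor whose weighted divergence vanishes after summation over \<open>l\<close>.\<close>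
  let ?F = "\<lambda>l y. P y $ i $ j * (w y * P y $ k $ l) + P y $ j $ k * (w y * P y $ i $ l) + P y $ k $ i * (w y * P y $ j $ l)"
  have "partial l (?F l) x = 0" for l
  proof -
    have "?F l y = 0" if "y \<in> S" for y
    proof -
      have "?F l y = w y * (P y $ i $ j * P y $ k $ l + P y $ j $ k * P y $ i $ l + P y $ k $ i * P y $ j $ l)"
        by (simp add: algebra_simps)
      with plucker[OF that] show ?thesis by (simp add: P_def)
    qed
    then have "partial l (\<lambda>y. 0) x = partial l (?F l) x"
      by (intro partial_cong_open[OF assms(1,2)]) auto
    then show ?thesis by (simp add: partial_def)
  qed
  then have "0 = (\<Sum>l\<in>UNIV. partial l (?F l) x)" by simp
  also have "\<dots> = (\<Sum>l\<in>UNIV. partial l (\<lambda>y. P y $ i $ j * (w y * P y $ k $ l)) x) +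
      (\<Sum>l\<in>UNIV. partial l (\<lambda>y. P y $ j $ k * (w y * P y $ i $ l)) x) +
      (\<Sum>l\<in>UNIV. partial l (\<lambda>y. P y $ k $ i * (w y * P y $ j $ l)) x)"
    by (simp only: partial_add dPQ differentiable_add sum.distrib)
  also have "\<dots> = w x * (T i j k + T j k i + T k i j)"
    by (simp only: T distrib_left)
  finally have "w x * (T i j k + T j k i + T k i j) = 0" by simp
  then have "T i j k + T j k i + T k i j = 0" using w(2) by simp
  moreover have "schouten \<pi> \<pi> c x i j k = 2 * (T i j k + T j k i + T k i j)"
    by (simp add: schouten_def T_def P_def sum.distrib sum_distrib_left)
  ultimately show ?thesis by simp
qed

section \<open>The bivector dual to an (m-2)-form\<close>

lemma sorted_length_CARD_minus2:
  fixes js :: "'m::{finite,linorder} list"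
  assumes "sorted_wrt (<) js" "length js = CARD('m) - 2" "2 \<le> CARD('m)"
  obtains i j where "i < j" "js = sorted_list_of_set (- {i, j})"
proof -
  have js: "sorted js" "distinct js" using assms(1) by (auto simp: strict_sorted_iff)
  have "card (- set js) = 2"
    using assms js by (simp add: distinct_card Compl_eq_Diff_UNIV card_Diff_subset)
  then obtain a b where ab: "- set js = {a, b}" "a \<noteq> b" by (meson card_2_iff)
  then have "\<exists>i j. i < j \<and> - set js = {i, j}"
    by (metis insert_commute linorder_neqE)
  then obtain i j where ij: "i < j" "- set js = {i, j}" by blast
  from ij(2) have "set js = - {i, j}" by (metis double_complement)
  with js have "js = sorted_list_of_set (- {i, j})"
    by (metis sorted_list_of_set.idem_if_sorted_distinct)
  with ij(1) that show ?thesis by blast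
qed

lemma sum_swap4:
  "(\<Sum>k\<in>A. \<Sum>l\<in>B. \<Sum>i\<in>C. \<Sum>j\<in>D. f k l i j) = (\<Sum>i\<in>C. \<Sum>j\<in>D. \<Sum>k\<in>A. \<Sum>l\<in>B. f k l i j)"
proof -
  have swap3: "(\<Sum>k\<in>A. \<Sum>l\<in>B. \<Sum>i\<in>C. g k l i) = (\<Sum>i\<in>C. \<Sum>k\<in>A. \<Sum>l\<in>B. g k l i)" for g C
  proof -
    have "(\<Sum>l\<in>B. \<Sum>i\<in>C. g k l i) = (\<Sum>i\<in>C. \<Sum>l\<in>B. g k l i)" for k by (rule sum.swap)
    then have "(\<Sum>k\<in>A. \<Sum>l\<in>B. \<Sum>i\<in>C. g k l i) = (\<Sum>k\<in>A. \<Sum>i\<in>C. \<Sum>l\<in>B. g k l i)"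
      by (simp only:)
    also have "\<dots> = (\<Sum>i\<in>C. \<Sum>k\<in>A. \<Sum>l\<in>B. g k l i)" by (rule sum.swap)
    finally show ?thesis .
  qed
  show ?thesis by (simp only: swap3)
qed

text \<open>The bivector \<open>\<pi>\<close> with \<open>\<sigma> = - 1/2 (\<Sum>k l. \<pi>\<^sup>k\<^sup>l \<Omega>(e\<^sub>k, e\<^sub>l, \<dots>))\<close>; this property determines it, which
  is why it is independent of the chart.\<close>

definition dual_bivector :: "('a, 'm::{finite,linorder}) form \<Rightarrow> ('a, 'm) form \<Rightarrow> ('a, 'm) bivector" where
  "dual_bivector \<Omega> \<sigma> c x = (\<chi> i j. eps i * eps j * coeff_matrix \<sigma> c x $ i $ j / \<Omega> c x full_basis)"

lemma dual_bivector_skew: "dual_bivector \<Omega> \<sigma> c x $ i $ j = - dual_bivector \<Omega> \<sigma> c x $ j $ i"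
  using coeff_matrix_skew[of \<sigma> c x i j] by (simp add: dual_bivector_def)

text \<open>Both sides are alternating, so increasing lists suffice. There the signs and the density
  in \<open>contraction_basis\<close> cancel those built into \<open>dual_bivector\<close>.\<close>

lemma dual_bivector_contraction:
  fixes \<sigma> \<Omega> :: "('a, 'm::{finite,linorder}) form"
  assumes "2 \<le> CARD('m)"
    and \<sigma>: "alternating_form (CARD('m) - 2) (\<sigma> c x)"
    and \<Omega>: "alternating_form CARD('m) (\<Omega> c x)" "\<Omega> c x full_basis \<noteq> 0"
  shows "(\<Sum>k\<in>UNIV. \<Sum>l\<in>UNIV. dual_bivector \<Omega> \<sigma> c x $ k $ l * \<Omega> c x (axis k 1 # axis l 1 # vs)) = -2 * \<sigma> c x vs"
proof (rule alternating_form_eqI[OF _ alternating_form_scale[OF \<sigma>]])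
  \<comment> \<open>Writing the dimension as a double successor removes the truncated subtraction,
    so that two arguments can be split off.\<close>
  obtain n where n: "CARD('m) = Suc (Suc n)" using assms(1) by (metis Suc_le_D numeral_2_eq_2 Suc_le_mono)
  show "alternating_form (CARD('m) - 2)
     (\<lambda>vs. \<Sum>k\<in>UNIV. \<Sum>l\<in>UNIV. dual_bivector \<Omega> \<sigma> c x $ k $ l * \<Omega> c x (axis k 1 # axis l 1 # vs))"
    using \<Omega>(1) unfolding n
    by (intro alternating_form_sum alternating_form_scale)
       (simp add: alternating_form_Cons[OF alternating_form_Cons])
next
  fix js :: "'m list" assume "sorted_wrt (<) js" "length js = CARD('m) - 2"
  then obtain i j where ij: "i < j" "js = sorted_list_of_set (- {i, j})"
    using sorted_length_CARD_minus2 assms(1) by blast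
  have "\<sigma> c x (basis_list js) = coeff_matrix \<sigma> c x $ i $ j"
    using coeff_matrix_eq[of i j \<sigma> c x] ij by simp
  then show "(\<Sum>k\<in>UNIV. \<Sum>l\<in>UNIV. dual_bivector \<Omega> \<sigma> c x $ k $ l * \<Omega> c x (axis k 1 # axis l 1 # basis_list js)) =
      -2 * \<sigma> c x (basis_list js)"
    unfolding ij(2) contraction_basis[OF \<Omega>(1) ij(1), of "\<lambda>k l. dual_bivector \<Omega> \<sigma> c x $ k $ l", OF dual_bivector_skew]
    using \<Omega>(2) by (simp add: dual_bivector_def mult_ac)
qed

text \<open>In the second chart both sides contract with \<Omega> to
  \<open>-2 * \<sigma> d y vs\<close>: the left by its defining property there, the right by the
  property in the first chart carried over by \<open>J\<close>. Injectivity of the contraction then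
  gives equality.\<close>

lemma dual_bivector_transform:
  fixes \<sigma> \<Omega> :: "('a, 'm::{finite,linorder}) form"
  assumes m: "2 \<le> CARD('m)"
    and \<sigma>: "alternating_form (CARD('m) - 2) (\<sigma> c x)" "alternating_form (CARD('m) - 2) (\<sigma> d y)"
    and \<Omega>: "alternating_form CARD('m) (\<Omega> c x)" "alternating_form CARD('m) (\<Omega> d y)"
    and nz: "\<Omega> c x full_basis \<noteq> 0" "\<Omega> d y full_basis \<noteq> 0"
    and tr: "\<And>vs. \<sigma> c x vs = \<sigma> d y (map (\<lambda>v. J *v v) vs)" "\<And>vs. \<Omega> c x vs = \<Omega> d y (map (\<lambda>v. J *v v) vs)"
  shows "dual_bivector \<Omega> \<sigma> d y = J ** dual_bivector \<Omega> \<sigma> c x ** transpose J"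
proof -
  let ?p = "dual_bivector \<Omega> \<sigma> c x" and ?q = "J ** dual_bivector \<Omega> \<sigma> c x ** transpose J"
  obtain n where n: "CARD('m) = Suc (Suc n)" using m by (metis Suc_le_D numeral_2_eq_2 Suc_le_mono)
  \<comment> \<open>The two densities differ by the factor \<open>det J\<close>, so nonvanishing of
    the volume form already makes \<open>J\<close> invertible.\<close>
  have "det J \<noteq> 0"
    using nz(1) tr(2)[of full_basis] top_form_map[OF \<Omega>(2), of J full_basis] by auto
  then obtain K where K: "J ** K = mat 1" by (metis invertible_def invertible_det_nz)
  have q: "?q $ i $ j = (\<Sum>k\<in>UNIV. \<Sum>l\<in>UNIV. ?p $ k $ l * (J $ i $ k * J $ j $ l))" for i j
  proof -
    have "?q $ i $ j = (\<Sum>l\<in>UNIV. \<Sum>k\<in>UNIV. ?p $ k $ l * (J $ i $ k * J $ j $ l))"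
      by (simp add: matrix_matrix_mult_def transpose_def sum_distrib_left sum_distrib_right mult_ac)
    also have "\<dots> = (\<Sum>k\<in>UNIV. \<Sum>l\<in>UNIV. ?p $ k $ l * (J $ i $ k * J $ j $ l))"
      by (rule sum.swap)
    finally show ?thesis .
  qed
  have "dual_bivector \<Omega> \<sigma> d y $ i $ j = ?q $ i $ j" for i j
  proof (rule contraction_inject[OF \<Omega>(2) nz(2), of "\<lambda>i j. dual_bivector \<Omega> \<sigma> d y $ i $ j" "\<lambda>i j. ?q $ i $ j"])
    show "dual_bivector \<Omega> \<sigma> d y $ i $ j = - dual_bivector \<Omega> \<sigma> d y $ j $ i" for i j
      by (rule dual_bivector_skew)
    show "?q $ i $ j = - ?q $ j $ i" for i j
    proof -
      have "?q $ i $ j = (\<Sum>k\<in>UNIV. \<Sum>l\<in>UNIV. - (?p $ l $ k * (J $ j $ l * J $ i $ k)))"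
        unfolding q by (intro sum.cong refl) (subst dual_bivector_skew, simp)
      also have "\<dots> = - ?q $ j $ i"
        unfolding q by (subst sum.swap) (simp add: sum_negf)
      finally show ?thesis .
    qed
    fix vs
    \<comment> \<open>Every list of test vectors in the second chart is the image under
      \<open>J\<close> of a list in the first, where the transformation laws of \<sigma> and
      \<Omega> apply.\<close>
    define us where "us = map (\<lambda>v. K *v v) vs"
    have us: "map (\<lambda>v. J *v v) us = vs"
      by (simp add: us_def o_def matrix_vector_mul_assoc K)
    have expand: "\<Omega> c x (axis k 1 # axis l 1 # us) =
        (\<Sum>i\<in>UNIV. \<Sum>j\<in>UNIV. J $ i $ k * J $ j $ l * \<Omega> d y (axis i 1 # axis j 1 # vs))" for k l
    proof -
      have "\<Omega> c x (axis k 1 # axis l 1 # us) = \<Omega> d y (column k J # column l J # vs)"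
        by (simp add: tr(2) us matrix_vector_mult_basis)
      also have "\<dots> = (\<Sum>i\<in>UNIV. \<Sum>j\<in>UNIV. column k J $ i * column l J $ j * \<Omega> d y (axis i 1 # axis j 1 # vs))"
        by (rule alternating_form_expand2[OF \<Omega>(2)[unfolded n]])
      finally show ?thesis by (simp only: column_def vec_lambda_beta)
    qed
    have "(\<Sum>i\<in>UNIV. \<Sum>j\<in>UNIV. dual_bivector \<Omega> \<sigma> d y $ i $ j * \<Omega> d y (axis i 1 # axis j 1 # vs)) =
        -2 * \<sigma> d y vs"
      by (rule dual_bivector_contraction[where \<sigma> = \<sigma> and \<Omega> = \<Omega> and c = d and x = y, OF m \<sigma>(2) \<Omega>(2) nz(2)])
    also have "\<dots> = -2 * \<sigma> c x us" by (simp add: tr(1) us)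
    also have "\<dots> = (\<Sum>k\<in>UNIV. \<Sum>l\<in>UNIV. ?p $ k $ l * \<Omega> c x (axis k 1 # axis l 1 # us))"
      by (rule dual_bivector_contraction[where \<sigma> = \<sigma> and \<Omega> = \<Omega> and c = c and x = x, OF m \<sigma>(1) \<Omega>(1) nz(1), of us, symmetric])
    also have "\<dots> = (\<Sum>k\<in>UNIV. \<Sum>l\<in>UNIV. ?p $ k $ l *
        (\<Sum>i\<in>UNIV. \<Sum>j\<in>UNIV. J $ i $ k * J $ j $ l * \<Omega> d y (axis i 1 # axis j 1 # vs)))"
      by (simp only: expand)
    also have "\<dots> = (\<Sum>k\<in>UNIV. \<Sum>l\<in>UNIV. \<Sum>i\<in>UNIV. \<Sum>j\<in>UNIV.
        ?p $ k $ l * (J $ i $ k * J $ j $ l) * \<Omega> d y (axis i 1 # axis j 1 # vs))"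
      by (simp add: sum_distrib_left mult_ac)
    also have "\<dots> = (\<Sum>i\<in>UNIV. \<Sum>j\<in>UNIV. \<Sum>k\<in>UNIV. \<Sum>l\<in>UNIV.
        ?p $ k $ l * (J $ i $ k * J $ j $ l) * \<Omega> d y (axis i 1 # axis j 1 # vs))"
      by (rule sum_swap4)
    also have "\<dots> = (\<Sum>i\<in>UNIV. \<Sum>j\<in>UNIV. ?q $ i $ j * \<Omega> d y (axis i 1 # axis j 1 # vs))"
      by (simp add: q sum_distrib_right)
    finally show "(\<Sum>i\<in>UNIV. \<Sum>j\<in>UNIV. dual_bivector \<Omega> \<sigma> d y $ i $ j * \<Omega> d y (axis i 1 # axis j 1 # vs)) =
        (\<Sum>i\<in>UNIV. \<Sum>j\<in>UNIV. ?q $ i $ j * \<Omega> d y (axis i 1 # axis j 1 # vs))" .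
  qed
  then show ?thesis by (simp add: vec_eq_iff)
qed

text \<open>Signs and density amount to multiplication by a diagonal matrix on each side.\<close>

lemma rank_dual_bivector:
  fixes \<sigma> \<Omega> :: "('a, 'm::{finite,linorder}) form"
  shows "rank (dual_bivector \<Omega> \<sigma> c x) \<le> rank (coeff_matrix \<sigma> c x)"
proof -
  let ?D = "(\<chi> i j. if i = j then eps i / \<Omega> c x full_basis else 0) :: ((real, 'm) vec, 'm) vec"
  let ?E = "(\<chi> i j. if i = j then eps i else 0) :: ((real, 'm) vec, 'm) vec"
  have if_left: "(if P then a else 0) * b = (if P then a * b else 0)"
    and if_right: "b * (if P then a else 0) = (if P then b * a else 0)"
    and if_div: "(if P then a else 0) / b = (if P then a / b else 0)" for P and a b :: real
    by simp_all
  have "dual_bivector \<Omega> \<sigma> c x = ?D ** coeff_matrix \<sigma> c x ** ?E"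
    by (simp add: vec_eq_iff dual_bivector_def matrix_matrix_mult_def if_left if_right if_div mult_ac)
  then show ?thesis
    using rank_mul_le_left[of "?D ** coeff_matrix \<sigma> c x" ?E] rank_mul_le_right[of ?D "coeff_matrix \<sigma> c x"]
    by simp
qed

lemma bivector_rank_eq_rank:
  assumes "transpose (\<pi> c x) = - \<pi> c x"
  shows "bivector_rank \<pi> c x = rank (\<pi> c x)"
proof -
  have "bivector_rank \<pi> c x = rank (transpose (\<pi> c x))"
    unfolding bivector_rank_def rank_dim_range by simp
  then show ?thesis by (simp add: rank_transpose)
qed

section \<open>Divergence-free vector fields\<close>

lemma skew_symmetric_sum_zero:
  fixes s q :: "'m::finite \<Rightarrow> 'm \<Rightarrow> real"
  assumes "\<And>i j. s i j = s j i" "\<And>i j. q i j = - q j i"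
  shows "(\<Sum>i\<in>UNIV. \<Sum>j\<in>UNIV. s i j * q i j) = 0"
proof -
  have "(\<Sum>i\<in>UNIV. \<Sum>j\<in>UNIV. s i j * q i j) = (\<Sum>i\<in>UNIV. \<Sum>j\<in>UNIV. - (s j i * q j i))"
    by (intro sum.cong refl) (metis assms mult_minus_right)
  also have "\<dots> = - (\<Sum>i\<in>UNIV. \<Sum>j\<in>UNIV. s i j * q i j)"
    by (subst sum.swap) (simp add: sum_negf)
  finally show ?thesis by simp
qed

lemma smooth_on_partial: "smooth_on S f \<Longrightarrow> smooth_on S (partial i f)"
  using smooth_on_frechet_derivative[of S f "axis i 1"] by (simp add: partial_def[abs_def])

lemma partial_partial_commute:
  assumes "open S" "x \<in> S" "smooth_on S f"
  shows "partial j (partial i f) x = partial i (partial j f) x"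
proof -
  have d: "(partial k f has_derivative frechet_derivative (partial k f) (at x)) (at x)" for k
    using smooth_on_imp_differentiable[OF smooth_on_partial[OF assms(3)] assms(2)]
    by (simp add: frechet_derivative_works)
  show ?thesis
    using second_derivative_symmetric[OF assms(1,2) smooth_on_imp_differentiable[OF assms(3)]
        d[unfolded partial_def[abs_def], of i] d[unfolded partial_def[abs_def], of j]]
    by (simp add: partial_def[abs_def])
qed

text \<open>The product rule gives second derivatives of \<open>f\<close>, which are symmetric and
  contracted with a skew array, and the gradient of \<open>f\<close> paired with the divergence of
  \<open>Q\<close>. The array \<open>Q\<close> will be the density times \<pi>.\<close>

lemma divergence_hamiltonian_zero:
  fixes f :: "real^'m::finite \<Rightarrow> real" and Q :: "'m \<Rightarrow> 'm \<Rightarrow> real^'m \<Rightarrow> real"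
  assumes "open S" "x \<in> S" "smooth_on S f"
    and Q: "\<And>i j. Q i j differentiable (at x)" "\<And>i j. Q i j x = - Q j i x"
      "\<And>i. (\<Sum>j\<in>UNIV. partial j (Q i j) x) = 0"
  shows "(\<Sum>j\<in>UNIV. partial j (\<lambda>y. \<Sum>i\<in>UNIV. partial i f y * Q i j y) x) = 0"
proof -
  have df: "partial i f differentiable (at x)" for i
    using smooth_on_imp_differentiable[OF smooth_on_partial[OF assms(3)] assms(2)] .
  have "(\<Sum>j\<in>UNIV. partial j (\<lambda>y. \<Sum>i\<in>UNIV. partial i f y * Q i j y) x) =
      (\<Sum>j\<in>UNIV. \<Sum>i\<in>UNIV. partial j (partial i f) x * Q i j x + partial i f x * partial j (Q i j) x)"
    by (simp only: partial_sum[OF differentiable_mult[OF df Q(1)]] partial_mult[OF df Q(1)])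
  also have "\<dots> = (\<Sum>j\<in>UNIV. \<Sum>i\<in>UNIV. partial j (partial i f) x * Q i j x) +
      (\<Sum>j\<in>UNIV. \<Sum>i\<in>UNIV. partial i f x * partial j (Q i j) x)"
    by (simp only: sum.distrib)
  also have "(\<Sum>j\<in>UNIV. \<Sum>i\<in>UNIV. partial j (partial i f) x * Q i j x) = 0"
    by (rule skew_symmetric_sum_zero[of "\<lambda>j i. partial j (partial i f) x" "\<lambda>j i. Q i j x"])
      (rule partial_partial_commute[OF assms(1-3)], rule Q(2))
  also have "(\<Sum>j\<in>UNIV. \<Sum>i\<in>UNIV. partial i f x * partial j (Q i j) x) =
      (\<Sum>i\<in>UNIV. partial i f x * (\<Sum>j\<in>UNIV. partial j (Q i j) x))"
    by (subst sum.swap) (simp only: sum_distrib_left)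
  finally show ?thesis by (simp add: Q(3))
qed

lemma has_derivative_sum_partial:
  fixes f :: "real^'m::finite \<Rightarrow> real"
  assumes "f differentiable (at x)"
  shows "frechet_derivative f (at x) v = (\<Sum>i\<in>UNIV. v $ i * partial i f x)"
proof -
  have lin: "linear (frechet_derivative f (at x))" by (rule linear_frechet_derivative[OF assms])
  have "frechet_derivative f (at x) v = frechet_derivative f (at x) (\<Sum>i\<in>UNIV. v $ i *\<^sub>R axis i 1)"
    using basis_expansion[of v] by (simp add: scalar_mult_eq_scaleR)
  then show ?thesis by (simp add: linear_sum[OF lin] linear_cmul[OF lin] partial_def)
qed

text \<open>Liouville's formula: by the symmetry of second derivatives, the spatial derivative of the flow
  solves the variational equation, so its determinant grows at the rate given by the trace.\<close>

lemma has_real_derivative_density_jacobian: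
  fixes g :: "real \<times> (real^'m::finite) \<Rightarrow> real^'m" and Y :: "real^'m \<Rightarrow> real^'m" and w :: "real^'m \<Rightarrow> real"
  assumes S: "open S" "(t, x) \<in> S"
    and g: "smooth_on S g"
    and ode: "\<And>s y. (s, y) \<in> S \<Longrightarrow> ((\<lambda>r. g (r, y)) has_vector_derivative Y (g (s, y))) (at s)"
    and Y: "\<And>s y. (s, y) \<in> S \<Longrightarrow> Y differentiable (at (g (s, y)))"
    and w: "w differentiable (at (g (t, x)))"
    and div: "(\<Sum>j\<in>UNIV. partial j (\<lambda>y. w y * Y y $ j) (g (t, x))) = 0"
  shows "((\<lambda>s. w (g (s, x)) * det (matrix (frechet_derivative (\<lambda>y. g (s, y)) (at x))))
    has_real_derivative 0) (at t)"
proof -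
  let ?g' = "\<lambda>z. frechet_derivative g (at z)"
  define q where "q = g (t, x)"
  define B where "B = matrix (frechet_derivative Y (at q))"
  define C where "C = (\<lambda>s. matrix (frechet_derivative (\<lambda>y. g (s, y)) (at x)))"
  have g': "(g has_derivative ?g' z) (at z)" if "z \<in> S" for z
    using smooth_on_imp_differentiable[OF g that] by (simp add: frechet_derivative_works)
  have slice: "((\<lambda>y. g (s, y)) has_derivative (\<lambda>v. ?g' (s, y) (0, v))) (at y)" if "(s, y) \<in> S" for s y
  proof -
    have "((\<lambda>y. (s, y)) has_derivative (\<lambda>v. (0, v))) (at y)" by (auto intro!: derivative_eq_intros)
    from has_derivative_compose[OF this g'[OF that]] show ?thesis .
  qed
  have time: "?g' (s, y) (1, 0) = Y (g (s, y))" if "(s, y) \<in> S" for s y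
  proof -
    have "((\<lambda>r. (r, y)) has_derivative (\<lambda>k. (k, 0))) (at s)" by (auto intro!: derivative_eq_intros)
    from has_derivative_compose[OF this g'[OF that]]
    have "((\<lambda>r. g (r, y)) has_derivative (\<lambda>k. ?g' (s, y) (k, 0))) (at s)" .
    with ode[OF that] have "(\<lambda>k. ?g' (s, y) (k, 0)) = (\<lambda>k. k *\<^sub>R Y (g (s, y)))"
      unfolding has_vector_derivative_def by (rule has_derivative_unique[rotated])
    then have "?g' (s, y) (1, 0) = 1 *\<^sub>R Y (g (s, y))" by metis
    then show ?thesis by simp
  qed
  have Y': "(Y has_derivative (*v) B) (at q)"
  proof -
    have "(Y has_derivative frechet_derivative Y (at q)) (at q)"
      using Y[OF S(2)] by (simp add: frechet_derivative_works q_def)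
    moreover have "(*v) B = frechet_derivative Y (at q)"
      using matrix_vector_mul(2)[OF linear_frechet_derivative[OF Y[OF S(2)]]] by (simp add: B_def q_def)
    ultimately show ?thesis by simp
  qed
  define S' where "S' = {s. (s, x) \<in> S}"
  have S': "open S'" "t \<in> S'"
  proof -
    have "S' = (\<lambda>s. (s, x)) -` S" by (auto simp: S'_def)
    moreover have "open ((\<lambda>s. (s, x)) -` S)"
      by (rule open_vimage[OF S(1)]) (intro continuous_intros)
    ultimately show "open S'" by simp
  qed (use S in \<open>simp add: S'_def\<close>)
  have C_eq: "C s $ i $ j = ?g' (s, x) (0, axis j 1) $ i" if "s \<in> S'" for s i j
    using frechet_derivative_at[OF slice[of s x]] that by (simp add: C_def matrix_def S'_def fun_eq_iff)
  have C_v: "?g' (s, x) (0, v) = C s *v v" if "s \<in> S'" for s v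
  proof -
    have d: "((\<lambda>y. g (s, y)) has_derivative (\<lambda>v. ?g' (s, x) (0, v))) (at x)"
      using slice that by (simp add: S'_def)
    from matrix_vector_mul(2)[OF has_derivative_linear[OF d]] show ?thesis
      unfolding C_def frechet_derivative_at[OF d, symmetric] by metis
  qed
  have mixed: "((\<lambda>s. ?g' (s, x) (0, v)) has_vector_derivative B *v (C t *v v)) (at t)" for v
  proof -
    let ?h = "\<lambda>z. ?g' z (0, v)"
    define L where "L = frechet_derivative ?h (at (t, x))"
    have L: "(?h has_derivative L) (at (t, x))"
      using smooth_on_imp_differentiable[OF smooth_on_frechet_derivative[OF g] S(2)]
      by (simp add: frechet_derivative_works L_def)
    have "((\<lambda>z. Y (g z)) has_derivative (\<lambda>z. B *v ?g' (t, x) z)) (at (t, x))"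
      using has_derivative_compose[OF g'[OF S(2)] Y'[unfolded q_def]] .
    \<comment> \<open>The flow equation holds on all of the open set \<open>S\<close>, so both of
      its sides can be differentiated at \<open>(t, x)\<close> in spatial directions too.\<close>
    then have K: "((\<lambda>z. ?g' z (1, 0)) has_derivative (\<lambda>z. B *v ?g' (t, x) z)) (at (t, x))"
      by (rule has_derivative_transform_within_open[OF _ S]) (auto simp: time)
    have "L (1, 0) = B *v ?g' (t, x) (0, v)"
      by (rule second_derivative_symmetric[OF S smooth_on_imp_differentiable[OF g] L K])
    then have L1: "L (1, 0) = B *v (C t *v v)" by (simp add: C_v[OF S'(2)])
    have "((\<lambda>s. (s, x)) has_derivative (\<lambda>k. (k, 0))) (at t)" by (auto intro!: derivative_eq_intros)
    from has_derivative_compose[OF this L]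
    have "((\<lambda>s. ?h (s, x)) has_derivative (\<lambda>k. L (k, 0))) (at t)" .
    moreover have "L (k, 0) = k *\<^sub>R (B *v (C t *v v))" for k
      using linear_cmul[OF has_derivative_linear[OF L], of k "(1, 0)"] by (simp add: L1)
    ultimately show ?thesis by (simp only: has_vector_derivative_def)
  qed
  have "((\<lambda>s. C s $ i $ j) has_real_derivative (B ** C t) $ i $ j) (at t)" for i j
  proof -
    have "((\<lambda>s. ?g' (s, x) (0, axis j 1) $ i) has_derivative (\<lambda>k. (k *\<^sub>R (B *v (C t *v axis j 1))) $ i)) (at t)"
      using mixed[of "axis j 1"] unfolding has_vector_derivative_def
      by (rule bounded_linear.has_derivative[OF bounded_linear_vec_nth])
    then have "((\<lambda>s. C s $ i $ j) has_derivative (\<lambda>k. (k *\<^sub>R (B *v (C t *v axis j 1))) $ i)) (at t)"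
      by (rule has_derivative_transform_within_open[OF _ S']) (simp add: C_eq)
    moreover have "(B *v (C t *v axis j 1)) $ i = (B ** C t) $ i $ j"
      by (simp add: matrix_vector_mult_basis column_def matrix_vector_mult_def[of B] matrix_matrix_mult_def)
    ultimately show ?thesis by (simp add: has_field_derivative_def mult.commute[of _ "(B ** C t) $ i $ j"])
  qed
  then have det: "((\<lambda>s. det (C s)) has_real_derivative trace B * det (C t)) (at t)"
    by (rule has_real_derivative_det)
  have wg: "((\<lambda>s. w (g (s, x))) has_real_derivative frechet_derivative w (at q) (Y q)) (at t)"
  proof -
    have "(w has_derivative frechet_derivative w (at q)) (at q)"
      using w by (simp add: frechet_derivative_works q_def)
    from has_derivative_compose[OF ode[OF S(2), unfolded has_vector_derivative_def] this[unfolded q_def]]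
    show ?thesis
      using linear_cmul[OF linear_frechet_derivative[OF w]]
      by (simp add: has_field_derivative_def q_def mult_commute_abs)
  qed
  have dY: "(\<lambda>y. Y y $ j) differentiable (at q)" and pY: "partial j (\<lambda>y. Y y $ j) q = B $ j $ j" for j
  proof -
    have d: "((\<lambda>y. Y y $ j) has_derivative (\<lambda>v. (B *v v) $ j)) (at q)"
      by (rule bounded_linear.has_derivative[OF bounded_linear_vec_nth Y'])
    then show "(\<lambda>y. Y y $ j) differentiable (at q)" by (auto simp: differentiable_def)
    show "partial j (\<lambda>y. Y y $ j) q = B $ j $ j"
      by (simp add: partial_def frechet_derivative_at[OF d, symmetric] matrix_vector_mult_basis column_def)
  qed
  \<comment> \<open>The weighted divergence splits into the derivative of \<open>w\<close> along
    \<open>Y\<close> and \<open>w\<close> times the trace. These are the rates of change of the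
    density and of the determinant along the orbit.\<close>
  have "0 = (\<Sum>j\<in>UNIV. partial j w q * Y q $ j + w q * B $ j $ j)"
    using div partial_mult[OF w[folded q_def] dY] by (simp add: q_def[symmetric] pY)
  also have "\<dots> = frechet_derivative w (at q) (Y q) + w q * trace B"
    using has_derivative_sum_partial[OF w[folded q_def], of "Y q"]
    by (simp add: sum.distrib trace_def sum_distrib_left mult.commute)
  finally have zero: "frechet_derivative w (at q) (Y q) + w q * trace B = 0" by simp
  have "((\<lambda>s. w (g (s, x)) * det (C s)) has_real_derivative
      frechet_derivative w (at q) (Y q) * det (C t) + (trace B * det (C t)) * w (g (t, x))) (at t)"
    by (rule DERIV_mult[OF wg det])
  also have "frechet_derivative w (at q) (Y q) * det (C t) + (trace B * det (C t)) * w (g (t, x)) =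
      (frechet_derivative w (at q) (Y q) + w q * trace B) * det (C t)"
    by (simp add: q_def algebra_simps)
  finally show ?thesis by (simp add: zero C_def)
qed

section \<open>Charts and flows\<close>

lemma is_chartD:
  assumes "is_chart M c"
  shows openin_chart_dom: "openin M (chart_dom c)" and open_chart_img: "open (chart_img c)"
    and inj_on_chart_map: "inj_on (chart_map c) (chart_dom c)"
    and chart_dom_subset: "chart_dom c \<subseteq> topspace M"
proof -
  show o: "openin M (chart_dom c)" "open (chart_img c)"
    using assms by (simp_all add: is_chart_def)
  then show sub: "chart_dom c \<subseteq> topspace M" by (simp add: openin_subset)
  have "homeomorphic_map (subtopology M (chart_dom c)) (top_of_set (chart_img c)) (chart_map c)"
    using assms by (simp add: is_chart_def)
  from homeomorphic_imp_injective_map[OF this] show "inj_on (chart_map c) (chart_dom c)"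
    using sub by (simp add: inf.absorb2)
qed

lemma chart_inv_chart_map:
  "is_chart M c \<Longrightarrow> p \<in> chart_dom c \<Longrightarrow> chart_inv c (chart_map c p) = p"
  by (simp add: chart_inv_def inj_on_chart_map)

lemma chart_map_chart_inv: "x \<in> chart_img c \<Longrightarrow> chart_map c (chart_inv c x) = x"
  by (simp add: chart_inv_def chart_img_def f_inv_into_f)

lemma chart_inv_in_dom: "x \<in> chart_img c \<Longrightarrow> chart_inv c x \<in> chart_dom c"
  by (simp add: chart_inv_def chart_img_def inv_into_into)

lemma chart_map_in_img: "p \<in> chart_dom c \<Longrightarrow> chart_map c p \<in> chart_img c"
  by (simp add: chart_img_def)

lemma chart_map_image_iff:
  assumes "is_chart M c"
  shows "x \<in> chart_map c ` (chart_dom c \<inter> U) \<longleftrightarrow> x \<in> chart_img c \<and> chart_inv c x \<in> U"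
proof
  assume "x \<in> chart_map c ` (chart_dom c \<inter> U)"
  then show "x \<in> chart_img c \<and> chart_inv c x \<in> U"
    using chart_inv_chart_map[OF assms] by (auto simp: chart_img_def)
next
  assume x: "x \<in> chart_img c \<and> chart_inv c x \<in> U"
  then have "x = chart_map c (chart_inv c x)" "chart_inv c x \<in> chart_dom c \<inter> U"
    by (simp_all add: chart_map_chart_inv chart_inv_in_dom)
  then show "x \<in> chart_map c ` (chart_dom c \<inter> U)" by (rule image_eqI)
qed

lemma open_chart_map_image:
  assumes "is_chart M c" "openin M U"
  shows "open (chart_map c ` (chart_dom c \<inter> U))"
proof -
  have "homeomorphic_map (subtopology M (chart_dom c)) (top_of_set (chart_img c)) (chart_map c)"
    using assms by (simp add: is_chart_def)
  then have "open_map (subtopology M (chart_dom c)) (top_of_set (chart_img c)) (chart_map c)"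
    by (rule homeomorphic_imp_open_map)
  moreover have "openin (subtopology M (chart_dom c)) (chart_dom c \<inter> U)"
    using assms(2) by (rule openin_subtopology_Int2)
  ultimately have "openin (top_of_set (chart_img c)) (chart_map c ` (chart_dom c \<inter> U))"
    by (simp add: open_map_def)
  then show ?thesis by (rule openin_open_trans) (rule open_chart_img[OF assms(1)])
qed

lemma smooth_manifoldD:
  assumes "smooth_manifold M A"
  shows smooth_manifold_chart: "c \<in> A \<Longrightarrow> is_chart M c"
    and smooth_manifold_cover: "p \<in> topspace M \<Longrightarrow> \<exists>c\<in>A. p \<in> chart_dom c"
    and smooth_manifold_compatible: "c \<in> A \<Longrightarrow> d \<in> A \<Longrightarrow> compatible c d"
  using assms unfolding smooth_manifold_def by blast+

lemma transition_differentiable: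
  assumes "smooth_manifold M A" "c \<in> A" "d \<in> A" "p \<in> chart_dom c" "p \<in> chart_dom d"
  shows "transition c d differentiable (at (chart_map c p))"
  using smooth_manifold_compatible[OF assms(1-3)] assms(4,5) unfolding compatible_def
  by (blast intro: smooth_on_imp_differentiable)

section \<open>Local flows read in charts\<close>

lemma is_flowD:
  assumes "is_flow M A X D \<phi>"
  shows is_flow_open: "openin (prod_topology euclideanreal M) D"
    and is_flow_start: "p \<in> topspace M \<Longrightarrow> (0, p) \<in> D"
    and is_flow_interval: "p \<in> topspace M \<Longrightarrow> is_interval {t. (t, p) \<in> D}"
    and is_flow_continuous: "continuous_map (subtopology (prod_topology euclideanreal M) D) M (\<lambda>(t, p). \<phi> t p)"
    and is_flow_smooth: "c \<in> A \<Longrightarrow> d \<in> A \<Longrightarrow>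
        smooth_on {(t, x). x \<in> chart_img c \<and> (t, chart_inv c x) \<in> D \<and> \<phi> t (chart_inv c x) \<in> chart_dom d}
          (\<lambda>(t, x). chart_map d (\<phi> t (chart_inv c x)))"
    and is_flow_zero: "p \<in> topspace M \<Longrightarrow> \<phi> 0 p = p"
    and is_flow_ode: "(t, p) \<in> D \<Longrightarrow> d \<in> A \<Longrightarrow> \<phi> t p \<in> chart_dom d \<Longrightarrow>
        ((\<lambda>s. chart_map d (\<phi> s p)) has_vector_derivative X d (chart_map d (\<phi> t p))) (at t)"
  using assms unfolding is_flow_def by blast+

definition flow_chart_dom ::
  "(real \<times> 'a) set \<Rightarrow> (real \<Rightarrow> 'a \<Rightarrow> 'a) \<Rightarrow> ('a, 'm::finite) chart \<Rightarrow> ('a, 'm) chart \<Rightarrow> (real \<times> (real^'m)) set" where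
  "flow_chart_dom D \<phi> c d =
    {(t, x). x \<in> chart_img c \<and> (t, chart_inv c x) \<in> D \<and> \<phi> t (chart_inv c x) \<in> chart_dom d}"

text \<open>Openness is what the calculus lemmas demand of a domain. It comes from a product box
  around the point of the flow domain, whose space factor is carried to coordinates by the
  chart.\<close>

lemma open_flow_chart_dom:
  assumes flow: "is_flow M A X D \<phi>" and c: "is_chart M c" and d: "is_chart M d"
  shows "open (flow_chart_dom D \<phi> c d)"
proof (rule open_prod_intro)
  fix z assume z: "z \<in> flow_chart_dom D \<phi> c d"
  let ?P = "prod_topology euclideanreal M"
  have "openin (subtopology ?P D) {z \<in> topspace (subtopology ?P D). (\<lambda>(t, p). \<phi> t p) z \<in> chart_dom d}"
    by (rule openin_continuous_map_preimage[OF is_flow_continuous[OF flow] openin_chart_dom[OF d]])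
  then have "openin ?P {z \<in> topspace (subtopology ?P D). (\<lambda>(t, p). \<phi> t p) z \<in> chart_dom d}"
    by (rule openin_trans_full) (rule is_flow_open[OF flow])
  moreover have "{z \<in> topspace (subtopology ?P D). (\<lambda>(t, p). \<phi> t p) z \<in> chart_dom d} =
      {z \<in> D. (\<lambda>(t, p). \<phi> t p) z \<in> chart_dom d}"
    using openin_subset[OF is_flow_open[OF flow]] by auto
  ultimately have op: "openin ?P {z \<in> D. (\<lambda>(t, p). \<phi> t p) z \<in> chart_dom d}" by simp
  obtain t x where tx: "z = (t, x)" by (cases z)
  have mem: "(t, chart_inv c x) \<in> {z \<in> D. (\<lambda>(t, p). \<phi> t p) z \<in> chart_dom d}"
    using z by (simp add: tx flow_chart_dom_def)
  obtain U V where UV: "openin euclideanreal U" "openin M V" "t \<in> U" "chart_inv c x \<in> V"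
    "U \<times> V \<subseteq> {z \<in> D. (\<lambda>(t, p). \<phi> t p) z \<in> chart_dom d}"
    using op[unfolded openin_prod_topology_alt, rule_format, OF mem] by blast
  let ?W = "chart_map c ` (chart_dom c \<inter> V)"
  have "x \<in> ?W" using z UV by (simp add: chart_map_image_iff[OF c] tx flow_chart_dom_def)
  moreover have "U \<times> ?W \<subseteq> flow_chart_dom D \<phi> c d"
  proof
    fix v assume "v \<in> U \<times> ?W"
    then obtain s y where v: "v = (s, y)" "s \<in> U" and y: "y \<in> ?W" by blast
    then have "(s, chart_inv c y) \<in> U \<times> V" using y by (simp add: chart_map_image_iff[OF c])
    with UV(5) have "(s, chart_inv c y) \<in> {z \<in> D. (\<lambda>(t, p). \<phi> t p) z \<in> chart_dom d}" by blast
    with y show "v \<in> flow_chart_dom D \<phi> c d"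
      by (simp add: chart_map_image_iff[OF c] flow_chart_dom_def v(1))
  qed
  ultimately show "\<exists>A B. open A \<and> open B \<and> z \<in> A \<times> B \<and> A \<times> B \<subseteq> flow_chart_dom D \<phi> c d"
    using UV open_chart_map_image[OF c UV(2)] by (intro exI[of _ U] exI[of _ ?W]) (auto simp: tx)
qed

text \<open>The Jacobian from the chain rule is the one in the transformation law of the form. This
  permits changing the target chart while following an orbit.\<close>

lemma form_pullback_chart_independent:
  fixes f :: "real^'n::finite \<Rightarrow> 'a"
  assumes M: "smooth_manifold M A" and \<omega>: "form_field k A \<omega>" and d: "d \<in> A" "d' \<in> A"
    and N: "open N" "x \<in> N" "\<And>y. y \<in> N \<Longrightarrow> f y \<in> chart_dom d \<and> f y \<in> chart_dom d'"
    and diff: "(\<lambda>y. chart_map d (f y)) differentiable (at x)"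
  shows "\<omega> d (chart_map d (f x)) (map (frechet_derivative (\<lambda>y. chart_map d (f y)) (at x)) vs) =
    \<omega> d' (chart_map d' (f x)) (map (frechet_derivative (\<lambda>y. chart_map d' (f y)) (at x)) vs)"
proof -
  let ?L = "frechet_derivative (\<lambda>y. chart_map d (f y)) (at x)"
  let ?T = "transition d d'"
  let ?J = "jacobian d d' (chart_map d (f x))"
  have T: "?T differentiable (at (chart_map d (f x)))"
    using transition_differentiable[OF M d] N by blast
  have "(?T has_derivative (*v) ?J) (at (chart_map d (f x)))"
    using T unfolding frechet_derivative_works jacobian_def
    by (simp only: matrix_vector_mul(2)[OF linear_frechet_derivative[OF T]])
  moreover have "((\<lambda>y. chart_map d (f y)) has_derivative ?L) (at x)"
    using diff by (simp add: frechet_derivative_works)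
  ultimately have "((\<lambda>y. ?T (chart_map d (f y))) has_derivative (\<lambda>v. ?J *v ?L v)) (at x)"
    using has_derivative_compose by blast
  then have "((\<lambda>y. chart_map d' (f y)) has_derivative (\<lambda>v. ?J *v ?L v)) (at x)"
    by (rule has_derivative_transform_within_open[OF _ N(1,2)])
       (use N(3) chart_inv_chart_map[OF smooth_manifold_chart[OF M d(1)]] in \<open>auto simp: transition_def\<close>)
  then have L': "frechet_derivative (\<lambda>y. chart_map d' (f y)) (at x) = (\<lambda>v. ?J *v ?L v)"
    by (rule frechet_derivative_at[symmetric])
  have "\<forall>p\<in>chart_dom d \<inter> chart_dom d'. \<forall>vs. \<omega> d (chart_map d p) vs =
      \<omega> d' (chart_map d' p) (map (\<lambda>v. jacobian d d' (chart_map d p) *v v) vs)"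
    using \<omega> d unfolding form_field_def by blast
  with N have "\<omega> d (chart_map d (f x)) (map ?L vs) = \<omega> d' (chart_map d' (f x)) (map (\<lambda>v. ?J *v v) (map ?L vs))"
    by blast
  then show ?thesis by (simp add: L' o_def)
qed

text \<open>The pulled-back form at a fixed point is locally constant in time, by Liouville's
  formula in any chart around the current position. The times of an orbit form an interval, so it
  equals its value at time 0, where the flow is the identity.\<close>

lemma flow_invariant_divergence_free:
  fixes \<Omega> :: "('a, 'm::{finite,linorder}) form"
  assumes M: "smooth_manifold M A" and \<Omega>: "form_field CARD('m) A \<Omega>"
    and X: "\<And>c x. c \<in> A \<Longrightarrow> x \<in> chart_img c \<Longrightarrow> X c differentiable (at x)"
    and div: "\<And>c x. c \<in> A \<Longrightarrow> x \<in> chart_img c \<Longrightarrow>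
      (\<Sum>j\<in>UNIV. partial j (\<lambda>y. \<Omega> c y full_basis * X c y $ j) x) = 0"
  shows "flow_invariant M A X \<Omega>"
proof -
  have "\<Omega> d (chart_map d (\<phi> t0 p))
          (map (frechet_derivative (\<lambda>x. chart_map d (\<phi> t0 (chart_inv c x))) (at (chart_map c p))) vs) =
        \<Omega> c (chart_map c p) vs"
    if flow: "is_flow M A X D \<phi>" and t0: "(t0, p) \<in> D" and cd: "c \<in> A" "d \<in> A"
      and p: "p \<in> chart_dom c" and q: "\<phi> t0 p \<in> chart_dom d" for D \<phi> t0 p c d vs
  proof -
    note chart = smooth_manifold_chart[OF M]
    define x where "x = chart_map c p"
    have x: "x \<in> chart_img c" "chart_inv c x = p"
      using p chart_inv_chart_map[OF chart[OF cd(1)]] by (simp_all add: x_def chart_map_in_img)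
    have pM: "p \<in> topspace M" using p chart_dom_subset[OF chart[OF cd(1)]] by blast
    define I where "I = {t. (t, p) \<in> D}"
    define S where "S = flow_chart_dom D \<phi> c"
    define G where "G = (\<lambda>(d :: ('a, 'm) chart) (t, y). chart_map d (\<phi> t (chart_inv c y)))"
    \<comment> \<open>The value at \<open>p\<close> of the pullback of \<Omega> by the flow at time
      \<open>t\<close>, computed in the target chart \<open>d\<close>.\<close>
    define V where "V = (\<lambda>d t. \<Omega> d (G d (t, x)) (map (frechet_derivative (\<lambda>y. G d (t, y)) (at x)) vs))"
    have opS: "open (S d)" if "d \<in> A" for d
      unfolding S_def by (rule open_flow_chart_dom[OF flow chart[OF cd(1)] chart[OF that]])
    have S_iff: "(t, y) \<in> S d \<longleftrightarrow> y \<in> chart_img c \<and> (t, chart_inv c y) \<in> D \<and> \<phi> t (chart_inv c y) \<in> chart_dom d" for t y d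
      by (simp add: S_def flow_chart_dom_def)
    have Sx: "(t, x) \<in> S d \<longleftrightarrow> t \<in> I \<and> \<phi> t p \<in> chart_dom d" for t d
      using x by (simp add: S_iff I_def)
    have smooth: "smooth_on (S d) (G d)" if "d \<in> A" for d
      using is_flow_smooth[OF flow cd(1) that] by (simp add: S_def flow_chart_dom_def G_def)
    have alt: "alternating_form CARD('m) (\<Omega> d y)" if "d \<in> A" "y \<in> chart_img d" for d y
      using \<Omega> that unfolding form_field_def by blast
    have slice: "(\<lambda>y. G d (t, y)) differentiable (at y)" if "d \<in> A" "(t, y) \<in> S d" for d t y
    proof -
      have "((\<lambda>y. (t, y)) has_derivative (\<lambda>v. (0, v))) (at y)" by (auto intro!: derivative_eq_intros)
      moreover have "(G d has_derivative frechet_derivative (G d) (at (t, y))) (at (t, y))"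
        using smooth_on_imp_differentiable[OF smooth[OF that(1)] that(2)] by (simp add: frechet_derivative_works)
      ultimately have "((\<lambda>y. G d (t, y)) has_derivative (\<lambda>v. frechet_derivative (G d) (at (t, y)) (0, v))) (at y)"
        by (rule has_derivative_compose)
      then show ?thesis by (auto simp: differentiable_def)
    qed
    have indep: "V d t = V d' t" if "d \<in> A" "d' \<in> A" "(t, x) \<in> S d" "(t, x) \<in> S d'" for d d' t
    proof -
      let ?N = "Pair t -` (S d \<inter> S d')"
      have "open ?N"
        by (intro open_vimage open_Int opS that continuous_intros)
      moreover have "x \<in> ?N" using that by simp
      ultimately show ?thesis
        using form_pullback_chart_independent[OF M \<Omega> that(1,2), of ?N x "\<lambda>y. \<phi> t (chart_inv c y)" vs]
          slice[OF that(1,3)] by (auto simp: V_def G_def S_iff)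
    qed
    have opT: "open {t. (t, x) \<in> S d}" if "d \<in> A" for d
    proof -
      have "open ((\<lambda>t. (t, x)) -` S d)" by (intro open_vimage opS that continuous_intros)
      then show ?thesis by (simp add: vimage_def)
    qed
    have V_deriv: "(V d has_real_derivative 0) (at t)" if d: "d \<in> A" and t: "(t, x) \<in> S d" for d t
    proof (cases "length vs = CARD('m)")
      \<comment> \<open>Forms are total on lists, so lists of the wrong length have to be covered;
        there everything is zero.\<close>
      case False
      have "V d s = 0" if "(s, x) \<in> S d" for s
        using that False d alternating_form_length[OF alt]
        by (auto simp: V_def G_def S_iff chart_map_in_img)
      then have "((\<lambda>s. 0) has_real_derivative 0) (at t) \<longleftrightarrow> (V d has_real_derivative 0) (at t)"
        using t by (intro DERIV_cong_ev refl eventually_mono[OF eventually_nhds_in_open[OF opT[OF d]]]) auto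
      then show ?thesis by simp
    next
      case True
      let ?K = "det (\<chi> i::'m. vs ! pos i)"
      let ?w = "\<lambda>y. \<Omega> d y full_basis"
      let ?F = "\<lambda>s. ?w (G d (s, x)) * det (matrix (frechet_derivative (\<lambda>y. G d (s, y)) (at x)))"
      have inimg: "G d (s, y) \<in> chart_img d" if "(s, y) \<in> S d" for s y
        using that by (simp add: G_def S_iff chart_map_in_img)
      \<comment> \<open>The test vectors enter only through the factor \<open>?K\<close>, which does
        not depend on time; density times Jacobian determinant is what Liouville's formula
        controls.\<close>
      have V_eq: "?F s * ?K = V d s" if "(s, x) \<in> S d" for s
      proof -
        let ?L = "frechet_derivative (\<lambda>y. G d (s, y)) (at x)"
        have "?L = (*v) (matrix ?L)"
          using matrix_vector_mul(2)[OF linear_frechet_derivative[OF slice[OF d that]]] by (rule sym)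
        then have "V d s = \<Omega> d (G d (s, x)) (map (\<lambda>v. matrix ?L *v v) vs)"
          unfolding V_def by metis
        also have "\<dots> = det (matrix ?L) * (?w (G d (s, x)) * ?K)"
          using top_form_map[OF alt[OF d inimg[OF that]], of "matrix ?L" vs]
            top_form_eq_det[OF alt[OF d inimg[OF that]] True] by simp
        finally show ?thesis by simp
      qed
      have "(?F has_real_derivative 0) (at t)"
      proof (rule has_real_derivative_density_jacobian[OF opS[OF d] t smooth[OF d]])
        show "((\<lambda>r. G d (r, y)) has_vector_derivative X d (G d (s, y))) (at s)" if "(s, y) \<in> S d" for s y
          using is_flow_ode[OF flow, of s "chart_inv c y" d] that d by (simp add: G_def S_iff)
        show "X d differentiable (at (G d (s, y)))" if "(s, y) \<in> S d" for s y
          by (rule X[OF d inimg[OF that]])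
        show "?w differentiable (at (G d (t, x)))"
          using \<Omega> d inimg[OF t] unfolding form_field_def by (blast intro: smooth_on_imp_differentiable)
        show "(\<Sum>j\<in>UNIV. partial j (\<lambda>y. ?w y * X d y $ j) (G d (t, x))) = 0"
          by (rule div[OF d inimg[OF t]])
      qed
      then have "((\<lambda>s. ?F s * ?K) has_real_derivative 0) (at t)"
        using DERIV_cmult_right by fastforce
      moreover have "((\<lambda>s. ?F s * ?K) has_real_derivative 0) (at t) \<longleftrightarrow> (V d has_real_derivative 0) (at t)"
        using t by (intro DERIV_cong_ev refl eventually_mono[OF eventually_nhds_in_open[OF opT[OF d]]]) (auto intro: V_eq)
      ultimately show ?thesis by blast
    qed
    have inM: "\<phi> t p \<in> topspace M" if "t \<in> I" for t
    proof -
      have "(t, p) \<in> topspace (subtopology (prod_topology euclideanreal M) D)"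
        using that pM by (simp add: I_def)
      then show ?thesis
        using continuous_map_image_subset_topspace[OF is_flow_continuous[OF flow]] by fastforce
    qed
    have "\<exists>e. e \<in> A \<and> \<phi> t p \<in> chart_dom e" if "t \<in> I" for t
      using smooth_manifold_cover[OF M inM[OF that]] by blast
    \<comment> \<open>A chart is chosen separately for each time. As \<open>V\<close> does not
      depend on the chart, even an erratic choice gives a locally constant function of time.\<close>
    then obtain ch where ch: "\<And>t. t \<in> I \<Longrightarrow> ch t \<in> A \<and> \<phi> t p \<in> chart_dom (ch t)" by metis
    have "V (ch t0) t0 = V (ch 0) 0"
    proof (rule connected_local_const[of I t0 0 "\<lambda>t. V (ch t) t"])
      show "connected I" using is_flow_interval[OF flow pM] by (simp add: I_def is_interval_connected)
      show "t0 \<in> I" "0 \<in> I" using t0 is_flow_start[OF flow pM] by (simp_all add: I_def)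
      show "\<forall>t\<in>I. \<forall>\<^sub>F s in at t within I. V (ch t) t = V (ch s) s"
      proof
        fix t assume t: "t \<in> I"
        let ?d = "ch t"
        have d: "?d \<in> A" "(t, x) \<in> S ?d" using ch[OF t] t by (simp_all add: Sx)
        obtain r where r: "r > 0" "ball t r \<subseteq> {s. (s, x) \<in> S ?d}"
          using opT[OF d(1)] d(2) open_contains_ball by blast
        have const: "V ?d s = V ?d t" if "s \<in> ball t r" for s
        proof -
          have "\<exists>k. \<forall>s\<in>ball t r. V ?d s = k"
          proof (rule has_field_derivative_zero_constant[OF convex_ball])
            fix s assume "s \<in> ball t r"
            with r(2) have "(s, x) \<in> S ?d" by blast
            then show "(V ?d has_field_derivative 0) (at s within ball t r)"
              by (rule has_field_derivative_at_within[OF V_deriv[OF d(1)]])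
          qed
          then show ?thesis using that r(1) by (metis centre_in_ball)
        qed
        have "V ?d t = V (ch s) s" if "s \<in> ball t r" "s \<in> I" for s
          using const[OF that(1)] indep[OF d(1), of "ch s" s] ch[OF that(2)] that r(2) by (auto simp: Sx)
        then show "\<forall>\<^sub>F s in at t within I. V ?d t = V (ch s) s"
          unfolding eventually_at using r(1) by (intro exI[of _ r]) (auto simp: dist_commute)
      qed
    qed
    moreover have "V (ch t0) t0 = V d t0"
    proof (rule indep[OF _ cd(2)])
      have "t0 \<in> I" using t0 by (simp add: I_def)
      with ch q show "ch t0 \<in> A" "(t0, x) \<in> S (ch t0)" "(t0, x) \<in> S d" by (simp_all add: Sx)
    qed
    moreover have "V (ch 0) 0 = V c 0"
    proof (rule indep[OF _ cd(1)])
      have "0 \<in> I" using is_flow_start[OF flow pM] by (simp add: I_def)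
      with ch[OF this] p show "ch 0 \<in> A" "(0, x) \<in> S (ch 0)" "(0, x) \<in> S c"
        by (simp_all add: Sx is_flow_zero[OF flow pM])
    qed
    moreover have "V c 0 = \<Omega> c x vs"
    proof -
      have G0: "y = G c (0, y)" if "y \<in> chart_img c" for y
        using that chart_dom_subset[OF chart[OF cd(1)]] chart_inv_in_dom[OF that]
        by (auto simp: G_def is_flow_zero[OF flow] chart_map_chart_inv subset_iff)
      have "((\<lambda>y. G c (0, y)) has_derivative (\<lambda>v. v)) (at x)"
        by (rule has_derivative_transform_within_open[OF has_derivative_ident open_chart_img[OF chart[OF cd(1)]] x(1) G0])
      then have "frechet_derivative (\<lambda>y. G c (0, y)) (at x) = (\<lambda>v. v)"
        by (rule frechet_derivative_at[symmetric])
      then show ?thesis using G0[OF x(1)] by (simp add: V_def)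
    qed
    ultimately show ?thesis by (simp add: V_def G_def x x_def[symmetric])
  qed
  then show ?thesis unfolding flow_invariant_def by blast
qed

section \<open>Hamiltonian form of the vector field\<close>

lemma coeff_matrix_cong:
  assumes "\<And>vs. \<omega> c x vs = r * \<omega>' c x vs"
  shows "coeff_matrix \<omega> c x $ i $ j = r * coeff_matrix \<omega>' c x $ i $ j"
  by (simp add: coeff_matrix_def assms)

lemma smooth_on_coeff_matrix:
  assumes "open S" "\<And>vs. smooth_on S (\<lambda>x. \<omega> c x vs)"
  shows "smooth_on S (\<lambda>x. coeff_matrix \<omega> c x $ i $ j)"
proof -
  consider "i < j" | "i = j" | "j < i" by (rule linorder_cases)
  then show ?thesis
  proof cases
    case 1
    then show ?thesis using assms(2) by (simp add: coeff_matrix_def)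
  next
    case 2
    then show ?thesis by (simp add: coeff_matrix_def smooth_on_const)
  next
    case 3
    then have "\<not> i < j" by auto
    with 3 show ?thesis
      using smooth_on_mult[OF assms(1) smooth_on_const[of S "-1"] assms(2)]
      by (auto simp: coeff_matrix_def)
  qed
qed

text \<open>Only an inequality, because the scalar will be a value of \<open>a\<close> and may be
  zero.\<close>

lemma rank_scaleR_le: "rank (r *\<^sub>R A) \<le> rank (A :: real^'n::finite^'m::finite)"
proof -
  have "(if P then c else 0) * b = (if P then c * b else 0)" for P and b c :: real by simp
  then have "r *\<^sub>R A = mat r ** A" by (simp add: vec_eq_iff matrix_matrix_mult_def mat_def)
  then show ?thesis using rank_mul_le_right by metis
qed

lemma form_fieldD:
  assumes "form_field k A \<omega>"
  shows form_field_alternating: "c \<in> A \<Longrightarrow> x \<in> chart_img c \<Longrightarrow> alternating_form k (\<omega> c x)"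
    and form_field_smooth: "c \<in> A \<Longrightarrow> smooth_on (chart_img c) (\<lambda>x. \<omega> c x vs)"
    and form_field_transform: "c \<in> A \<Longrightarrow> d \<in> A \<Longrightarrow> p \<in> chart_dom c \<Longrightarrow> p \<in> chart_dom d \<Longrightarrow>
      \<omega> c (chart_map c p) vs = \<omega> d (chart_map d p) (map (\<lambda>v. jacobian c d (chart_map c p) *v v) vs)"
  using assms unfolding form_field_def by blast+

lemma smooth_fun_on_chart:
  assumes "smooth_manifold M A" "smooth_fun_on A (topspace M) a" "c \<in> A"
  shows "smooth_on (chart_img c) (\<lambda>x. a (chart_inv c x))"
proof -
  have "chart_dom c \<inter> topspace M = chart_dom c"
    using chart_dom_subset[OF smooth_manifold_chart[OF assms(1,3)]] by blast
  with assms(2,3) show ?thesis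
    unfolding smooth_fun_on_def chart_img_def o_def by metis
qed

lemma form_field_scale:
  assumes M: "smooth_manifold M A" and a: "smooth_fun_on A (topspace M) a" and \<omega>: "form_field k A \<omega>"
  shows "form_field k A (scale_form a \<omega>)"
  unfolding form_field_def
proof (intro conjI ballI allI)
  fix c x assume "c \<in> A" "x \<in> chart_img c"
  then show "alternating_form k (scale_form a \<omega> c x)"
    using alternating_form_scale[OF form_field_alternating[OF \<omega>]] by (simp add: scale_form_def[abs_def])
next
  fix c vs assume c: "c \<in> A"
  from smooth_on_mult[OF open_chart_img[OF smooth_manifold_chart[OF M c]] smooth_fun_on_chart[OF M a c] form_field_smooth[OF \<omega> c]]
  show "smooth_on (chart_img c) (\<lambda>x. scale_form a \<omega> c x vs)"
    by (simp add: scale_form_def)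
next
  fix c d p vs assume c: "c \<in> A" and d: "d \<in> A" and p: "p \<in> chart_dom c \<inter> chart_dom d"
  then show "scale_form a \<omega> c (chart_map c p) vs =
    scale_form a \<omega> d (chart_map d p) (map ((*v) (jacobian c d (chart_map c p))) vs)"
    using form_field_transform[OF \<omega> c d, of p vs]
    by (simp add: scale_form_def chart_inv_chart_map[OF smooth_manifold_chart[OF M]])
qed

lemma differentiable_vec_lambda:
  fixes f :: "'n::finite \<Rightarrow> 'a::real_normed_vector \<Rightarrow> real"
  assumes "\<And>i. f i differentiable (at x)"
  shows "(\<lambda>y. \<chi> i. f i y) differentiable (at x)"
  using has_derivative_vec_lambda[of f, OF assms[unfolded frechet_derivative_works]]
  unfolding differentiable_def by blast

theorem theorem3p14:
  fixes M :: "'a topology"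
    and A :: "('a, 'm::{finite, linorder}) chart set"
    and X :: "('a, 'm, (real, 'm) vec) field"
    and \<Omega> \<rho> :: "('a, 'm) form"
    and a :: "'a \<Rightarrow> real"
  assumes "CARD('m) \<ge> 2"
    and "smooth_manifold M A"
    and "orientable M A"
    and "vector_field A X"
    and "volume_form A \<Omega>"
    and "form_field (CARD('m) - 2) A \<rho>"
    and "field_eq_on A (topspace M) (interior_product X \<Omega>) (ext_deriv \<rho>)"
    and "\<forall>c\<in>A. \<forall>x\<in>chart_img c. form_rank \<rho> c x \<le> 2"
    and "smooth_fun_on A (topspace M) a"
    and "field_eq_on A (topspace M) (ext_deriv (scale_form a \<rho>)) (\<lambda>c x vs. 0)"
  shows "\<exists>\<pi>. poisson_structure M A \<pi> \<and> unimodular M A \<pi> \<and>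
           (\<forall>c\<in>A. \<forall>x\<in>chart_img c. bivector_rank \<pi> c x \<le> 2) \<and>
           (\<exists>h. smooth_fun_on A {p \<in> topspace M. a p \<noteq> 0} h \<and>
                field_eq_on A {p \<in> topspace M. a p \<noteq> 0} X (sharp \<pi> (differential h)))"
proof -
  note m = assms(1) and M = assms(2)
  note chart = smooth_manifold_chart[OF M]
  note opn = open_chart_img[OF chart]

  \<comment> \<open>The dual bivector: smoothness, skewness and rank\<close>
  define \<sigma> where "\<sigma> = scale_form a \<rho>"
  define \<pi> where "\<pi> = dual_bivector \<Omega> \<sigma>"
  define w where "w = (\<lambda>c x. \<Omega> c x full_basis)"
  have \<Omega>: "form_field CARD('m) A \<Omega>" using assms(5) by (simp add: volume_form_def)
  note \<rho> = assms(6)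
  have \<sigma>: "form_field (CARD('m) - 2) A \<sigma>"
    unfolding \<sigma>_def by (rule form_field_scale[OF M assms(9) \<rho>])
  have w0: "w c x \<noteq> 0" if "c \<in> A" "x \<in> chart_img c" for c x
    using assms(5) that top_form_full_basis_nonzero[OF form_field_alternating[OF \<Omega> that]]
    unfolding volume_form_def w_def by blast
  have dom: "chart_dom c \<subseteq> topspace M" if "c \<in> A" for c
    by (rule chart_dom_subset[OF chart[OF that]])
  \<comment> \<open>\<open>field_eq_on\<close> speaks of points of \<open>M\<close>; this makes the
    hypotheses available at coordinate points.\<close>
  have at_img: "\<exists>p\<in>chart_dom c \<inter> topspace M. x = chart_map c p" if "c \<in> A" "x \<in> chart_img c" for c x
    using that dom chart_inv_in_dom[OF that(2)] chart_map_chart_inv[OF that(2)] by (metis IntI subset_iff)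
  have smooth_a: "smooth_on (chart_img c) (\<lambda>x. a (chart_inv c x))" if "c \<in> A" for c
    by (rule smooth_fun_on_chart[OF M assms(9) that])
  have smooth_w: "smooth_on (chart_img c) (w c)" if "c \<in> A" for c
    using form_field_smooth[OF \<Omega> that] by (simp add: w_def)
  have smooth_R: "smooth_on (chart_img c) (\<lambda>x. coeff_matrix \<sigma> c x $ i $ j)"
    and smooth_R': "smooth_on (chart_img c) (\<lambda>x. coeff_matrix \<rho> c x $ i $ j)" if "c \<in> A" for c i j
    by (rule smooth_on_coeff_matrix[where \<omega> = \<sigma> and c = c, OF opn[OF that] form_field_smooth[OF \<sigma> that]])
       (rule smooth_on_coeff_matrix[where \<omega> = \<rho> and c = c, OF opn[OF that] form_field_smooth[OF \<rho> that]])
  have R_eq: "coeff_matrix \<sigma> c x $ i $ j = a (chart_inv c x) * coeff_matrix \<rho> c x $ i $ j" for c x i j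
    by (rule coeff_matrix_cong) (simp add: \<sigma>_def scale_form_def)
  have \<pi>_eq: "\<pi> c x $ i $ j = eps i * eps j * coeff_matrix \<sigma> c x $ i $ j / w c x" for c x i j
    by (simp add: \<pi>_def dual_bivector_def w_def)
  have skew: "\<pi> c x $ i $ j = - \<pi> c x $ j $ i" for c x i j
    unfolding \<pi>_def by (rule dual_bivector_skew)
  have transp: "transpose (\<pi> c x) = - \<pi> c x" for c x
  proof -
    have "transpose (\<pi> c x) $ i $ j = (- \<pi> c x) $ i $ j" for i j
      using skew[of c x j i] by (simp add: transpose_def)
    then show ?thesis by (simp add: vec_eq_iff)
  qed
  have smooth_\<pi>: "smooth_on (chart_img c) (\<lambda>x. \<pi> c x $ i $ j)" if "c \<in> A" for c i j
  proof -
    have "smooth_on (chart_img c) (\<lambda>x. (eps i * eps j) * coeff_matrix \<sigma> c x $ i $ j * inverse (w c x))"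
      by (intro smooth_on_mult smooth_on_inverse smooth_on_const opn smooth_R smooth_w w0 that)
    then show ?thesis by (simp add: \<pi>_eq divide_inverse mult.assoc)
  qed
  have rank\<pi>: "rank (\<pi> c x) \<le> 2" if "c \<in> A" "x \<in> chart_img c" for c x
  proof -
    have "coeff_matrix \<sigma> c x = a (chart_inv c x) *\<^sub>R coeff_matrix \<rho> c x"
      by (simp add: vec_eq_iff R_eq)
    then have "rank (coeff_matrix \<sigma> c x) \<le> rank (coeff_matrix \<rho> c x)"
      using rank_scaleR_le by metis
    moreover have "rank (\<pi> c x) \<le> rank (coeff_matrix \<sigma> c x)"
      unfolding \<pi>_def by (rule rank_dual_bivector)
    moreover have "rank (coeff_matrix \<rho> c x) \<le> 2"
      using assms(8) that by (simp add: form_rank_def)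
    ultimately show ?thesis by linarith
  qed

  \<comment> \<open>Closedness of \<open>a\<rho>\<close> as a divergence equation\<close>
  have ext_\<sigma>: "(\<Sum>j\<in>UNIV. eps j * partial j (\<lambda>y. coeff_matrix \<sigma> c y $ j $ i) x) = 0"
    if "c \<in> A" "x \<in> chart_img c" for c x i
  proof -
    have "ext_deriv \<sigma> c x (basis_list (sorted_list_of_set (- {i}))) = 0"
      using assms(10) at_img[OF that] that(1) unfolding field_eq_on_def \<sigma>_def by (auto simp: fun_eq_iff)
    then show ?thesis
      using ext_deriv_omit[of \<sigma> c x i] smooth_on_imp_differentiable[OF form_field_smooth[OF \<sigma> that(1)] that(2)]
      by simp
  qed
  have dQ: "(\<lambda>y. w c y * \<pi> c y $ i $ j) differentiable (at x)" if "c \<in> A" "x \<in> chart_img c" for c x i j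
    using smooth_on_imp_differentiable[OF smooth_on_mult[OF opn smooth_w smooth_\<pi>]] that by blast
  have div\<pi>: "(\<Sum>l\<in>UNIV. partial l (\<lambda>y. w c y * \<pi> c y $ k $ l) x) = 0"
    if "c \<in> A" "x \<in> chart_img c" for c x k
  proof -
    \<comment> \<open>The density cancels the denominator of \<pi>, so only coefficients of \<sigma>
      are differentiated; skewness puts their indices in the order of \<open>ext_\<sigma>\<close>
      and produces the minus sign.\<close>
    have "partial l (\<lambda>y. w c y * \<pi> c y $ k $ l) x =
        - eps k * (eps l * partial l (\<lambda>y. coeff_matrix \<sigma> c y $ l $ k) x)" for l
    proof -
      have "partial l (\<lambda>y. w c y * \<pi> c y $ k $ l) x =
          partial l (\<lambda>y. (- eps k * eps l) * coeff_matrix \<sigma> c y $ l $ k) x"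
        by (rule partial_cong_open[OF opn[OF that(1)] that(2) _ dQ[OF that]])
           (use w0[OF that(1)] coeff_matrix_skew[of \<sigma> c _ k l] in \<open>simp add: \<pi>_eq\<close>)
      also have "\<dots> = (- eps k * eps l) * partial l (\<lambda>y. coeff_matrix \<sigma> c y $ l $ k) x"
        by (rule partial_cmult[OF smooth_on_imp_differentiable[OF smooth_R[OF that(1)] that(2)]])
      finally show ?thesis by simp
    qed
    then show ?thesis by (simp only: sum_distrib_left[symmetric] ext_\<sigma>[OF that] mult_zero_right)
  qed

  \<comment> \<open>The Poisson property\<close>
  have bivector: "bivector_field A \<pi>"
    unfolding bivector_field_def
  proof (intro conjI ballI)
    show "transpose (\<pi> c x) = - \<pi> c x" for c x by (rule transp)
    show "smooth_on (chart_img c) (\<pi> c)" if "c \<in> A" for c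
    proof -
      have "smooth_on (chart_img c) (\<lambda>x. \<chi> i. \<chi> j. \<pi> c x $ i $ j)"
        by (intro smooth_on_vec_lambda opn smooth_\<pi> that)
      then show ?thesis by simp
    qed
    fix c d p assume c: "c \<in> A" and d: "d \<in> A" and p: "p \<in> chart_dom c \<inter> chart_dom d"
    then have img: "chart_map c p \<in> chart_img c" "chart_map d p \<in> chart_img d"
      by (simp_all add: chart_map_in_img)
    show "\<pi> d (chart_map d p) = jacobian c d (chart_map c p) ** \<pi> c (chart_map c p) **
        transpose (jacobian c d (chart_map c p))"
      unfolding \<pi>_def
    proof (rule dual_bivector_transform[OF m])
      show "\<sigma> c (chart_map c p) vs =
          \<sigma> d (chart_map d p) (map ((*v) (jacobian c d (chart_map c p))) vs)" for vs
        by (rule form_field_transform[OF \<sigma> c d]) (use p in auto)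
      show "\<Omega> c (chart_map c p) vs =
          \<Omega> d (chart_map d p) (map ((*v) (jacobian c d (chart_map c p))) vs)" for vs
        by (rule form_field_transform[OF \<Omega> c d]) (use p in auto)
      show "\<Omega> c (chart_map c p) full_basis \<noteq> 0" "\<Omega> d (chart_map d p) full_basis \<noteq> 0"
        using w0[OF c img(1)] w0[OF d img(2)] by (simp_all add: w_def)
    qed (intro form_field_alternating[OF \<sigma>] form_field_alternating[OF \<Omega>] c d img)+
  qed
  have "schouten \<pi> \<pi> c x i j k = 0" if "c \<in> A" "x \<in> chart_img c" for c x i j k
  proof (rule schouten_self_zero[OF opn[OF that(1)] that(2)
        smooth_on_imp_differentiable[OF smooth_w[OF that(1)] that(2)] w0[OF that]])
    show "(\<lambda>y. \<pi> c y $ i $ j) differentiable (at x)" for i j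
      by (rule smooth_on_imp_differentiable[OF smooth_\<pi>[OF that(1)] that(2)])
    show "\<pi> c y $ i $ j * \<pi> c y $ k $ l + \<pi> c y $ j $ k * \<pi> c y $ i $ l + \<pi> c y $ k $ i * \<pi> c y $ j $ l = 0"
      if "y \<in> chart_img c" for y i j k l
      by (rule skew_rank2_plucker[OF skew rank\<pi>[OF \<open>c \<in> A\<close> that]])
    show "(\<Sum>l\<in>UNIV. partial l (\<lambda>y. w c y * \<pi> c y $ k $ l) x) = 0" for k
      by (rule div\<pi>[OF that])
  qed
  then have poisson: "poisson_structure M A \<pi>"
    unfolding poisson_structure_def field_eq_on_def using bivector by (auto simp: fun_eq_iff chart_map_in_img)

  \<comment> \<open>Unimodularity\<close>
  have "flow_invariant M A (sharp \<pi> (differential h)) \<Omega>" if h: "smooth_fun_on A (topspace M) h" for h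
  proof (rule flow_invariant_divergence_free[OF M \<Omega>])
    fix c x assume c: "c \<in> A" and x: "x \<in> chart_img c"
    define f where "f = h \<circ> chart_inv c"
    have f: "smooth_on (chart_img c) f"
      using smooth_fun_on_chart[OF M h c] by (simp add: f_def o_def)
    have Xh: "sharp \<pi> (differential h) c y = (\<chi> j. \<Sum>i\<in>UNIV. \<pi> c y $ i $ j * partial i f y)" for y
      by (simp add: sharp_def differential_def vector_matrix_mult_def f_def mult.commute)
    have dX: "(\<lambda>y. \<Sum>i\<in>UNIV. \<pi> c y $ i $ j * partial i f y) differentiable (at x)" for j
      by (intro differentiable_sum differentiable_mult ballI finite
          smooth_on_imp_differentiable[OF smooth_\<pi>[OF c] x] smooth_on_imp_differentiable[OF smooth_on_partial[OF f] x])
    show "sharp \<pi> (differential h) c differentiable (at x)"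
      using differentiable_vec_lambda[OF dX] by (simp add: Xh[abs_def])
    have skewQ: "w c x * \<pi> c x $ i $ j = - (w c x * \<pi> c x $ j $ i)" for i j
      using skew[of c x i j] by simp
    have "(\<lambda>y. \<Omega> c y full_basis * sharp \<pi> (differential h) c y $ j) =
        (\<lambda>y. \<Sum>i\<in>UNIV. partial i f y * (w c y * \<pi> c y $ i $ j))" for j
      by (simp add: Xh w_def sum_distrib_left mult_ac)
    then show "(\<Sum>j\<in>UNIV. partial j (\<lambda>y. \<Omega> c y full_basis * sharp \<pi> (differential h) c y $ j) x) = 0"
      using divergence_hamiltonian_zero[OF opn[OF c] x f, of "\<lambda>i j y. w c y * \<pi> c y $ i $ j",
          OF dQ[OF c x] skewQ div\<pi>[OF c x]]
      by (simp only:)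
  qed
  then have unimod: "unimodular M A \<pi>" unfolding unimodular_def using assms(5) by blast
  have rank: "\<forall>c\<in>A. \<forall>x\<in>chart_img c. bivector_rank \<pi> c x \<le> 2"
    using rank\<pi> by (simp add: bivector_rank_eq_rank transp)

  \<comment> \<open>The Hamiltonian function where \<open>a\<close> is nonzero\<close>
  define U where "U = {p \<in> topspace M. a p \<noteq> 0}"
  \<comment> \<open>The convention \<open>inverse 0 = 0\<close> makes \<open>h\<close> total; its
    values at zeros of \<open>a\<close> lie outside \<open>U\<close>.\<close>
  define h where "h = (\<lambda>p. inverse (a p))"
  have V: "open (chart_map c ` (chart_dom c \<inter> U))"
    "chart_map c ` (chart_dom c \<inter> U) = {x \<in> chart_img c. a (chart_inv c x) \<noteq> 0}" if c: "c \<in> A" for c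
  proof -
    show eq: "chart_map c ` (chart_dom c \<inter> U) = {x \<in> chart_img c. a (chart_inv c x) \<noteq> 0}"
    proof (rule set_eqI)
      fix x
      have "chart_inv c x \<in> topspace M" if "x \<in> chart_img c"
        using dom[OF c] chart_inv_in_dom[OF that] by blast
      then show "x \<in> chart_map c ` (chart_dom c \<inter> U) \<longleftrightarrow> x \<in> {x \<in> chart_img c. a (chart_inv c x) \<noteq> 0}"
        by (auto simp: chart_map_image_iff[OF chart[OF c]] U_def)
    qed
    have "open (chart_img c \<inter> (\<lambda>x. a (chart_inv c x)) -` (- {0}))"
      by (rule continuous_open_preimage[OF smooth_on_imp_continuous_on[OF smooth_a[OF c]] opn[OF c]]) auto
    moreover have "chart_img c \<inter> (\<lambda>x. a (chart_inv c x)) -` (- {0}) = {x \<in> chart_img c. a (chart_inv c x) \<noteq> 0}"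
      by auto
    ultimately show "open (chart_map c ` (chart_dom c \<inter> U))" by (simp add: eq)
  qed
  have smooth_h: "smooth_fun_on A U h"
    unfolding smooth_fun_on_def
  proof
    fix c assume c: "c \<in> A"
    have "smooth_on (chart_map c ` (chart_dom c \<inter> U)) (\<lambda>x. inverse (a (chart_inv c x)))"
      by (rule smooth_on_inverse[OF V(1)[OF c] smooth_on_subset[OF smooth_a[OF c]]]) (auto simp: V(2)[OF c])
    then show "smooth_on (chart_map c ` (chart_dom c \<inter> U)) (h \<circ> chart_inv c)" by (simp add: h_def o_def)
  qed
  have "X c x = sharp \<pi> (differential h) c x" if c: "c \<in> A" and x: "x \<in> chart_img c" and nz: "a (chart_inv c x) \<noteq> 0" for c x
  proof -
    define b where "b = (\<lambda>y. a (chart_inv c y))"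
    have db: "b differentiable (at x)" and b0: "b x \<noteq> 0"
      using smooth_on_imp_differentiable[OF smooth_a[OF c] x] nz by (simp_all add: b_def)
    have bx: "a (chart_inv c x) = b x" by (simp add: b_def)
    have dh: "partial j (h \<circ> chart_inv c) x = - partial j b x / (b x)\<^sup>2" for j
    proof -
      have "((\<lambda>y. inverse (b y)) has_derivative (\<lambda>v. - (inverse (b x) * frechet_derivative b (at x) v * inverse (b x)))) (at x)"
        using db b0 by (auto intro!: derivative_eq_intros simp: frechet_derivative_works)
      then have "frechet_derivative (\<lambda>y. inverse (b y)) (at x) =
          (\<lambda>v. - (inverse (b x) * frechet_derivative b (at x) v * inverse (b x)))"
        by (rule frechet_derivative_at[symmetric])
      then show ?thesis
        by (simp add: partial_def h_def b_def o_def divide_inverse power2_eq_square)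
    qed
    have "X c x $ i = sharp \<pi> (differential h) c x $ i" for i
    proof -
      let ?R = "\<lambda>j y. coeff_matrix \<rho> c y $ j $ i"
      have dR: "?R j differentiable (at x)" for j
        by (rule smooth_on_imp_differentiable[OF smooth_R'[OF c] x])
      let ?S = "\<Sum>j\<in>UNIV. eps j * partial j (?R j) x"
      \<comment> \<open>On the coordinate vectors other than \<open>i\<close>, contraction with
        \<open>X\<close> sees only component \<open>i\<close>; any other component would repeat a
        vector.\<close>
      have "interior_product X \<Omega> c x (basis_list (sorted_list_of_set (- {i}))) =
          (\<Sum>l\<in>UNIV. X c x $ l * \<Omega> c x (axis l 1 # basis_list (sorted_list_of_set (- {i}))))"
        unfolding interior_product_def by (rule alternating_form_expand[OF form_field_alternating[OF \<Omega> c x]])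
      also have "\<dots> = (\<Sum>l\<in>UNIV. if l = i then X c x $ i * (eps i * w c x) else 0)"
        using top_form_omit[OF form_field_alternating[OF \<Omega> c x], of i]
          top_form_omit_other[OF form_field_alternating[OF \<Omega> c x], of _ i]
        by (intro sum.cong refl) (simp add: w_def)
      also have "\<dots> = X c x $ i * (eps i * w c x)" by simp
      finally have "X c x $ i * (eps i * w c x) = interior_product X \<Omega> c x (basis_list (sorted_list_of_set (- {i})))" ..
      also have "\<dots> = ext_deriv \<rho> c x (basis_list (sorted_list_of_set (- {i})))"
        using assms(7) at_img[OF c x] c unfolding field_eq_on_def by (metis)
      also have "\<dots> = ?S"
        by (rule ext_deriv_omit[where \<omega> = \<rho> and c = c, OF smooth_on_imp_differentiable[OF form_field_smooth[OF \<rho> c] x]])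
      finally have XS: "X c x $ i * (eps i * w c x) = ?S" .
      \<comment> \<open>The product rule for the derivative of \<open>a\<rho>\<close> trades the
        gradient of \<open>a\<close> for \<open>?S\<close>, which \<open>XS\<close> has identified
        with a component of \<open>X\<close>.\<close>
      have "0 = (\<Sum>j\<in>UNIV. eps j * partial j (\<lambda>y. b y * ?R j y) x)"
        using ext_\<sigma>[OF c x, of i] by (simp add: R_eq b_def)
      also have "\<dots> = (\<Sum>j\<in>UNIV. eps j * partial j b x * ?R j x) + b x * ?S"
        by (simp add: partial_mult[OF db dR] sum.distrib[symmetric] sum_distrib_left algebra_simps)
      finally have zero: "(\<Sum>j\<in>UNIV. eps j * partial j b x * ?R j x) = - b x * ?S" by simp
      have "sharp \<pi> (differential h) c x $ i = (\<Sum>j\<in>UNIV. \<pi> c x $ j $ i * partial j (h \<circ> chart_inv c) x)"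
        by (simp add: sharp_def differential_def vector_matrix_mult_def mult.commute)
      \<comment> \<open>The gradient of \<open>1/a\<close> has denominator
        \<open>(b x)\<^sup>2\<close> and \<pi> contains one factor \<open>b x\<close>; the remaining
        denominator cancels against the factor supplied by \<open>zero\<close>.\<close>
      also have "\<dots> = (\<Sum>j\<in>UNIV. - (eps i / (w c x * b x)) * (eps j * partial j b x * ?R j x))"
        using b0 w0[OF c x] by (intro sum.cong refl) (simp add: dh \<pi>_eq R_eq bx power2_eq_square field_simps)
      also have "\<dots> = - (eps i / (w c x * b x)) * (- b x * ?S)"
        by (simp only: sum_distrib_left[symmetric] zero)
      also have "\<dots> = eps i / w c x * (X c x $ i * (eps i * w c x))"
        using b0 by (simp add: XS[symmetric])
      also have "\<dots> = X c x $ i" using w0[OF c x] by simp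
      finally show ?thesis ..
    qed
    then show ?thesis by (simp add: vec_eq_iff)
  qed
  then have "field_eq_on A U X (sharp \<pi> (differential h))"
    unfolding field_eq_on_def by (auto simp: U_def chart_map_in_img chart_inv_chart_map[OF chart])
  with poisson unimod rank smooth_h show ?thesis unfolding U_def by blast
qed

end
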